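(* There is a sequence of CQs ${\boldsymbol q}_n$ and ontologies $\mathcal{T}_n$ of depth $1$, both of size polynomial in $n$, such that every PE-rewriting of ${\boldsymbol q}_n$ and $\mathcal{T}_n$ has size $n^{\Omega(\log n)}$.
   Context: An ontology $\mathcal{T}$ is a finite set of tgds $\forall \vec{x}\,(\varphi(\vec{x}) \to \exists \vec{y} \bigwedge_i \psi_i(\vec{x},\vec{y}))$, where $\varphi$ and the $\psi_i$ are unary or binary atoms without constants and $|\vec{x}\cup\vec{y}|\le 2$; $|\mathcal{T}|$ is the number of predicate occurrences. A data instance $\mathcal{A}$ is a finite set of ground atoms with constants $\mathsf{ind}(\mathcal{A})$; it is complete if every ground atom $S(\vec{a})$, $\vec{a}\subseteq\mathsf{ind}(\mathcal{A})$, entailed by $\mathcal{T},\mathcal{A}$ belongs to $\mathcal{A}$. A CQ ${\boldsymbol q}(\vec{x})=\exists\vec{y}\,\varphi(\vec{x},\vec{y})$ has $\varphi$ a conjunction of unary or binary atoms over variables (no constants). A PE-rewriting of ${\boldsymbol q}(\vec{x})$ and $\mathcal{T}$ is a positive existential first-order formula ${\boldsymbol q}'(\vec{x})$ without constants (built from atoms and equalities using $\land,\lor,\exists$) such that for every complete data instance $\mathcal{A}$ and tuple $\vec{a}\subseteq\mathsf{ind}(\mathcal{A})$: $\mathcal{T},\mathcal{A}\models{\boldsymbol q}(\vec{a})$ (i.e. ${\boldsymbol q}(\vec a)$ holds in all models of $\mathcal{T}\cup\mathcal{A}$) iff $\mathcal{A}\models{\boldsymbol q}'(\vec{a})$. Its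 size is its length. For $\varrho(x)$ of the form $S(x)$, $S(x,x)$, $\exists y\,S(x,y)$ or $\exists y\,S(y,x)$ with $S$ a predicate of $\mathcal{T}$, $\mathcal{C}_\mathcal{T}^{\varrho(a)}$ is the canonical model (chase) of $(\mathcal{T}\cup\{A(x)\to\varrho(x)\},\{A(a)\})$ with $A$ fresh. $\mathcal{T}$ is of depth $k$ if some $\mathcal{C}_\mathcal{T}^{\varrho(a)}$ contains a chain $R_0(w_0,w_1),\dots,R_{k-1}(w_{k-1},w_k)$ (the $w_i$ not necessarily distinct) but none contains a longer such chain.
   Formalization: In the definition of depth, loops R(w,w) do not count as chain steps (consecutive w_i must differ), since otherwise the root S(x,x) leaves no ontology of depth 1; models range over countable domains, which leaves entailment unchanged by Löwenheim–Skolem. *)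

theory Defs
  imports Complex_Main "HOL-Library.Landau_Symbols"
begin

type_synonym pred = nat
type_synonym var = nat
type_synonym const = nat

text \<open>Unary and binary predicate symbols are kept apart by the constructor, so \<open>Unary P\<close> and
  \<open>Binary P\<close> are different symbols. Atoms over \<open>var\<close> occur in formulas; atoms over any other type
  are facts, and a set of facts together with a domain is a relational structure.\<close>

datatype 'a atom = Unary pred 'a | Binary pred 'a 'a

text \<open>\<open>Tgd \<phi> \<psi>s\<close> stands for \<open>\<forall>x (\<phi> \<rightarrow> \<exists>y \<And>\<psi>s)\<close>, where \<open>x\<close> are the variables of \<open>\<phi>\<close> and \<open>y\<close> the
  remaining variables of \<open>\<psi>s\<close>.\<close>

datatype tgd = Tgd (body: "var atom") (head: "var atom list")

definition tgd_atoms :: "tgd \<Rightarrow> var atom set" where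
  "tgd_atoms \<sigma> = insert (body \<sigma>) (set (head \<sigma>))"

definition tgd_vars :: "tgd \<Rightarrow> var set" where
  "tgd_vars \<sigma> = (\<Union>\<alpha>\<in>tgd_atoms \<sigma>. set_atom \<alpha>)"

definition ontology :: "tgd set \<Rightarrow> bool" where
  "ontology T \<longleftrightarrow> finite T \<and> (\<forall>\<sigma>\<in>T. head \<sigma> \<noteq> [] \<and> card (tgd_vars \<sigma>) \<le> 2)"

definition ontology_size :: "tgd set \<Rightarrow> nat" where
  "ontology_size T = (\<Sum>\<sigma>\<in>T. 1 + length (head \<sigma>))"

definition unary_preds :: "tgd set \<Rightarrow> pred set" where
  "unary_preds T = {S. \<exists>\<sigma>\<in>T. \<exists>x. Unary S x \<in> tgd_atoms \<sigma>}"

definition binary_preds :: "tgd set \<Rightarrow> pred set" where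
  "binary_preds T = {S. \<exists>\<sigma>\<in>T. \<exists>x y. Binary S x y \<in> tgd_atoms \<sigma>}"

definition data_instance :: "const atom set \<Rightarrow> bool" where
  "data_instance A \<longleftrightarrow> finite A"

definition ind :: "const atom set \<Rightarrow> const set" where
  "ind A = (\<Union>\<alpha>\<in>A. set_atom \<alpha>)"

definition sat_tgd :: "'d set \<Rightarrow> 'd atom set \<Rightarrow> tgd \<Rightarrow> bool" where
  "sat_tgd D F \<sigma> \<longleftrightarrow>
    (\<forall>v. range v \<subseteq> D \<and> map_atom v (body \<sigma>) \<in> F \<longrightarrow>
      (\<exists>v'. range v' \<subseteq> D \<and> (\<forall>x\<in>set_atom (body \<sigma>). v' x = v x) \<and>
        (\<forall>\<psi>\<in>set (head \<sigma>). map_atom v' \<psi> \<in> F)))"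

text \<open>A first-order model of \<open>T \<union> A\<close>: domain \<open>D\<close>, interpretation \<open>c\<close> of the constants, true
  facts \<open>F\<close>. The domain is an arbitrary nonempty subset of \<open>nat\<close>; by the downward
  Loewenheim-Skolem theorem the entailments below are the same as over all models.\<close>

definition is_model ::
    "tgd set \<Rightarrow> const atom set \<Rightarrow> nat set \<Rightarrow> (const \<Rightarrow> nat) \<Rightarrow> nat atom set \<Rightarrow> bool" where
  "is_model T A D c F \<longleftrightarrow>
    D \<noteq> {} \<and> range c \<subseteq> D \<and> (\<forall>\<alpha>\<in>F. set_atom \<alpha> \<subseteq> D) \<and>
    (\<forall>\<sigma>\<in>T. sat_tgd D F \<sigma>) \<and> (\<forall>\<alpha>\<in>A. map_atom c \<alpha> \<in> F)"

definition entails_atom :: "tgd set \<Rightarrow> const atom set \<Rightarrow> const atom \<Rightarrow> bool" where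
  "entails_atom T A \<alpha> \<longleftrightarrow> (\<forall>D c F. is_model T A D c F \<longrightarrow> map_atom c \<alpha> \<in> F)"

definition complete_instance :: "tgd set \<Rightarrow> const atom set \<Rightarrow> bool" where
  "complete_instance T A \<longleftrightarrow>
    (\<forall>\<alpha>. set_atom \<alpha> \<subseteq> ind A \<and> entails_atom T A \<alpha> \<longrightarrow> \<alpha> \<in> A)"

text \<open>\<open>CQ xs \<alpha>s\<close> stands for \<open>\<exists>y \<And>\<alpha>s\<close> with answer variables \<open>xs\<close>, where \<open>y\<close> are the variables
  of \<open>\<alpha>s\<close> not in \<open>xs\<close>.\<close>

datatype cq = CQ (ans_vars: "var list") (cq_atoms: "var atom list")

definition wf_cq :: "cq \<Rightarrow> bool" where
  "wf_cq q \<longleftrightarrow> distinct (ans_vars q) \<and> cq_atoms q \<noteq> []"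

definition ex_vars :: "cq \<Rightarrow> var set" where
  "ex_vars q = (\<Union>\<alpha>\<in>set (cq_atoms q). set_atom \<alpha>) - set (ans_vars q)"

definition sat_cq :: "'d set \<Rightarrow> 'd atom set \<Rightarrow> (var \<Rightarrow> 'd) \<Rightarrow> cq \<Rightarrow> bool" where
  "sat_cq D F v q \<longleftrightarrow>
    (\<exists>v'. (\<forall>x\<in>set (ans_vars q). v' x = v x) \<and> v' ` ex_vars q \<subseteq> D \<and>
      (\<forall>\<alpha>\<in>set (cq_atoms q). map_atom v' \<alpha> \<in> F))"

text \<open>A tuple of constants for the answer variables is given by an assignment \<open>t\<close>, of which only
  the values on the answer variables matter.\<close>

definition entails_cq :: "tgd set \<Rightarrow> const atom set \<Rightarrow> cq \<Rightarrow> (var \<Rightarrow> const) \<Rightarrow> bool" where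
  "entails_cq T A q t \<longleftrightarrow> (\<forall>D c F. is_model T A D c F \<longrightarrow> sat_cq D F (c \<circ> t) q)"

datatype pe =
    Atom "var atom"
  | Eq var var
  | And pe pe
  | Or pe pe
  | Ex var pe

primrec pe_free :: "pe \<Rightarrow> var set" where
  "pe_free (Atom \<alpha>) = set_atom \<alpha>"
| "pe_free (Eq x y) = {x, y}"
| "pe_free (And f g) = pe_free f \<union> pe_free g"
| "pe_free (Or f g) = pe_free f \<union> pe_free g"
| "pe_free (Ex x f) = pe_free f - {x}"

primrec sat_pe :: "'d set \<Rightarrow> 'd atom set \<Rightarrow> (var \<Rightarrow> 'd) \<Rightarrow> pe \<Rightarrow> bool" where
  "sat_pe D F v (Atom \<alpha>) \<longleftrightarrow> map_atom v \<alpha> \<in> F"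
| "sat_pe D F v (Eq x y) \<longleftrightarrow> v x = v y"
| "sat_pe D F v (And f g) \<longleftrightarrow> sat_pe D F v f \<and> sat_pe D F v g"
| "sat_pe D F v (Or f g) \<longleftrightarrow> sat_pe D F v f \<or> sat_pe D F v g"
| "sat_pe D F v (Ex x f) \<longleftrightarrow> (\<exists>d\<in>D. sat_pe D F (v(x := d)) f)"

definition pe_rewriting :: "cq \<Rightarrow> tgd set \<Rightarrow> pe \<Rightarrow> bool" where
  "pe_rewriting q T f \<longleftrightarrow>
    pe_free f \<subseteq> set (ans_vars q) \<and>
    (\<forall>A t. data_instance A \<and> complete_instance T A \<and> t ` set (ans_vars q) \<subseteq> ind A \<longrightarrow>
      (entails_cq T A q t \<longleftrightarrow> sat_pe (ind A) A t f))"

text \<open>Lengths count occurrences of predicates, variables, equality signs, connectives and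
  quantifiers; brackets and commas would only contribute a constant factor.\<close>

primrec atom_size :: "'a atom \<Rightarrow> nat" where
  "atom_size (Unary P x) = 2"
| "atom_size (Binary P x y) = 3"

primrec pe_size :: "pe \<Rightarrow> nat" where
  "pe_size (Atom \<alpha>) = atom_size \<alpha>"
| "pe_size (Eq x y) = 3"
| "pe_size (And f g) = pe_size f + 1 + pe_size g"
| "pe_size (Or f g) = pe_size f + 1 + pe_size g"
| "pe_size (Ex x f) = 2 + pe_size f"

definition cq_size :: "cq \<Rightarrow> nat" where
  "cq_size q = length (ans_vars q) + 2 * card (ex_vars q) +
    (\<Sum>\<alpha>\<leftarrow>cq_atoms q. atom_size \<alpha>) + (length (cq_atoms q) - 1)"

text \<open>The canonical model is the oblivious chase: every match of the body of \<open>\<sigma>\<close> fires once, and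
  \<open>Null \<sigma> y \<beta>\<close> is the labelled null invented for the existential variable \<open>y\<close> when \<open>\<sigma>\<close> fires on
  the fact \<open>\<beta>\<close>.\<close>

datatype elem = Cst const | Null tgd var "elem atom"

definition fire :: "tgd \<Rightarrow> (var \<Rightarrow> elem) \<Rightarrow> var \<Rightarrow> elem" where
  "fire \<sigma> v z =
    (if z \<in> set_atom (body \<sigma>) then v z else Null \<sigma> z (map_atom v (body \<sigma>)))"

inductive_set chase :: "tgd set \<Rightarrow> const atom set \<Rightarrow> elem atom set"
  for T :: "tgd set" and A :: "const atom set" where
  data: "\<alpha> \<in> A \<Longrightarrow> map_atom Cst \<alpha> \<in> chase T A"
| step: "\<sigma> \<in> T \<Longrightarrow> map_atom v (body \<sigma>) \<in> chase T A \<Longrightarrow> \<psi> \<in> set (head \<sigma>)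
    \<Longrightarrow> map_atom (fire \<sigma> v) \<psi> \<in> chase T A"

text \<open>The formulas \<open>S(x)\<close>, \<open>S(x,x)\<close>, \<open>\<exists>y S(x,y)\<close> and \<open>\<exists>y S(y,x)\<close>, with \<open>x\<close> and \<open>y\<close> written as the
  variables \<open>0\<close> and \<open>1\<close>.\<close>

definition root_atoms :: "tgd set \<Rightarrow> var atom set" where
  "root_atoms T = {Unary S 0 |S. S \<in> unary_preds T} \<union>
    (\<Union>S\<in>binary_preds T. {Binary S 0 0, Binary S 0 1, Binary S 1 0})"

definition root_models :: "tgd set \<Rightarrow> elem atom set set" where
  "root_models T = {chase (insert (Tgd (Unary P 0) [\<rho>]) T) {Unary P a} |P \<rho> a.
    P \<notin> unary_preds T \<and> \<rho> \<in> root_atoms T}"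

text \<open>The elements of a chain may repeat, but a loop \<open>R(w,w)\<close> is not a step of a chain.
  Without this proviso no ontology would have depth \<open>1\<close>: see \<open>loop_in_root_model\<close>.\<close>

definition has_chain :: "'d atom set \<Rightarrow> nat \<Rightarrow> bool" where
  "has_chain F k \<longleftrightarrow>
    (\<exists>w R. \<forall>i<k. w i \<noteq> w (Suc i) \<and> Binary (R i) (w i) (w (Suc i)) \<in> F)"

definition of_depth :: "tgd set \<Rightarrow> nat \<Rightarrow> bool" where
  "of_depth T k \<longleftrightarrow>
    (\<exists>C\<in>root_models T. has_chain C k) \<and> (\<forall>C\<in>root_models T. \<forall>m>k. \<not> has_chain C m)"

lemma loop_in_root_model:
  assumes "finite T" "S \<in> binary_preds T"
  shows "\<exists>C\<in>root_models T. \<exists>w. Binary S w w \<in> C"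
proof -
  have "finite (unary_preds T)"
  proof -
    have "unary_preds T \<subseteq> (\<lambda>\<alpha>. case \<alpha> of Unary S x \<Rightarrow> S | Binary S x y \<Rightarrow> S) ` (\<Union>\<sigma>\<in>T. tgd_atoms \<sigma>)"
      by (force simp: unary_preds_def)
    moreover have "finite (\<Union>\<sigma>\<in>T. tgd_atoms \<sigma>)"
      using assms by (auto simp: tgd_atoms_def)
    ultimately show ?thesis
      by (meson finite_imageI finite_subset)
  qed
  then obtain P where P: "P \<notin> unary_preds T"
    using ex_new_if_finite infinite_UNIV_nat by blast
  let ?\<sigma> = "Tgd (Unary P 0) [Binary S 0 0]"
  let ?C = "chase (insert ?\<sigma> T) {Unary P 0}"
  have "map_atom Cst (Unary P 0) \<in> ?C"
    by (rule chase.data) simp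
  then have "map_atom (fire ?\<sigma> (\<lambda>_. Cst 0)) (Binary S 0 0) \<in> ?C"
    by (intro chase.step) auto
  moreover have "?C \<in> root_models T"
    using P assms(2) by (auto simp: root_models_def root_atoms_def)
  ultimately show ?thesis
    by auto
qed

end

theory Submission
  imports Defs "HOL-Library.Nat_Bijection" "HOL-Library.Discrete_Functions"
begin

text \<open>Over a data instance with a single constant, a PE-rewriting is a monotone Boolean formula of at
  most the same size. The ontology attaches to the constant one null with incoming and one with outgoing
  edges, and the query asks for a set of nodes that contains \<open>s\<close>, omits \<open>t\<close> and is closed under those
  edges of a fixed layered graph which the data do not switch off. So a rewriting is a monotone formula
  for non-reachability, the dual of \<open>s\<close>-\<open>t\<close>-connectivity.

  Such a formula gives a protocol for the fork game of Grigni and Sipser: one player holds the path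
  through the nodes \<open>x\<^sub>1, \<dots>, x\<^sub>l\<close>, the other the cut around \<open>y\<^sub>1, \<dots>, y\<^sub>l\<close>, and they look for
  an edge at which the path leaves the cut. Spending \<open>r\<close> bits makes the set \<open>S\<close> of remaining words
  sparser by a factor \<open>2 ^ r\<close>, while halving the length of the words makes it denser again, to about
  the square root. Words of length \<open>2 ^ r\<close> can be halved \<open>r\<close> times, so \<open>r\<^sup>2\<close> bits are needed
  for an alphabet of size \<open>2 ^ (8 r)\<close>. As formulas can be balanced, the size is \<open>2 ^ \<Omega>(r\<^sup>2)\<close>.\<close>

section \<open>Communication games\<close>

text \<open>\<open>comm R c X Y\<close>: players holding \<open>x \<in> X\<close> and \<open>y \<in> Y\<close> can agree on an \<open>i\<close> with \<open>R x y i\<close> by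
  exchanging at most \<open>c\<close> bits.\<close>

inductive comm :: "('a \<Rightarrow> 'b \<Rightarrow> 'i \<Rightarrow> bool) \<Rightarrow> nat \<Rightarrow> 'a set \<Rightarrow> 'b set \<Rightarrow> bool"
  for R where
  leaf: "(\<And>x y. x \<in> X \<Longrightarrow> y \<in> Y \<Longrightarrow> R x y i) \<Longrightarrow> comm R c X Y"
| left: "comm R c X1 Y \<Longrightarrow> comm R c X2 Y \<Longrightarrow> X \<subseteq> X1 \<union> X2 \<Longrightarrow> comm R (Suc c) X Y"
| right: "comm R c X Y1 \<Longrightarrow> comm R c X Y2 \<Longrightarrow> Y \<subseteq> Y1 \<union> Y2 \<Longrightarrow> comm R (Suc c) X Y"

lemma comm_simulate:
  assumes "comm R c X Y"
    and "f ` X' \<subseteq> X" "g ` Y' \<subseteq> Y"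
    and "\<And>x y i. x \<in> X' \<Longrightarrow> y \<in> Y' \<Longrightarrow> R (f x) (g y) i \<Longrightarrow> R' x y (h i)"
  shows "comm R' c X' Y'"
  using assms
proof (induction arbitrary: X' Y' rule: comm.induct)
  case (leaf X Y i c)
  then show ?case by (intro comm.leaf[where i = "h i"]) blast
next
  case (left c X1 Y X2 X)
  have "comm R' c (X' \<inter> f -` X1) Y'"
    by (rule left.IH(1)) (use left.prems in auto)
  moreover have "comm R' c (X' \<inter> f -` X2) Y'"
    by (rule left.IH(2)) (use left.prems in auto)
  ultimately show ?case by (rule comm.left) (use left.hyps(3) left.prems(1) in blast)
next
  case (right c X Y1 Y2 Y)
  have "comm R' c X' (Y' \<inter> g -` Y1)"
    by (rule right.IH(1)) (use right.prems in auto)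
  moreover have "comm R' c X' (Y' \<inter> g -` Y2)"
    by (rule right.IH(2)) (use right.prems in auto)
  ultimately show ?case by (rule comm.right) (use right.hyps(3) right.prems(2) in blast)
qed

lemma comm_subset: "comm R c X Y \<Longrightarrow> X' \<subseteq> X \<Longrightarrow> Y' \<subseteq> Y \<Longrightarrow> comm R c X' Y'"
  by (erule comm_simulate[where f = id and g = id and h = id]) auto

lemma comm_mono: "comm R c X Y \<Longrightarrow> c \<le> c' \<Longrightarrow> comm R c' X Y"
proof (induction arbitrary: c' rule: comm.induct)
  case (leaf X Y i c)
  then show ?case by (blast intro: comm.leaf)
next
  case (left c X1 Y X2 X)
  then obtain c'' where "c' = Suc c''" "c \<le> c''" by (cases c') auto
  then show ?case using left by (auto intro: comm.left)
next
  case (right c X Y1 Y2 Y)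
  then obtain c'' where "c' = Suc c''" "c \<le> c''" by (cases c') auto
  then show ?case using right by (auto intro: comm.right)
qed

lemma comm_0: "comm R 0 X Y \<Longrightarrow> \<exists>i. \<forall>x\<in>X. \<forall>y\<in>Y. R x y i"
  by (erule comm.cases) auto

lemma half_of_cover:
  assumes "finite S" "S \<subseteq> A \<union> B"
  shows "\<exists>S'\<subseteq>S. (S' \<subseteq> A \<or> S' \<subseteq> B) \<and> card S \<le> 2 * card S'"
proof -
  have "card S \<le> card (S \<inter> A) + card (S \<inter> B)"
    by (metis assms(2) card_Un_le inf.absorb1 inf_sup_distrib1)
  then have "card S \<le> 2 * card (S \<inter> A) \<or> card S \<le> 2 * card (S \<inter> B)" by linarith
  then show ?thesis by (meson inf.cobounded1 inf.cobounded2)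
qed

text \<open>After each bit, the larger part of \<open>S\<close> for the player who spoke is kept for
  both players, so the game stays on a square.\<close>

lemma comm_halve:
  assumes "comm R (c + t) S S" "finite S"
  shows "\<exists>S'\<subseteq>S. comm R c S' S' \<and> card S \<le> 2 ^ t * card S'"
  using assms
proof (induction t arbitrary: S)
  case 0
  then show ?case by auto
next
  case (Suc t)
  from Suc.prems(1) have "comm R (Suc (c + t)) S S" by simp
  then have "\<exists>S1\<subseteq>S. comm R (c + t) S1 S1 \<and> card S \<le> 2 * card S1"
  proof cases
    case (leaf i)
    then have "comm R (c + t) S S" by (blast intro: comm.leaf)
    then show ?thesis by (intro exI[of _ S]) auto
  next
    case (left X1 X2)
    then show ?thesis using half_of_cover[OF Suc.prems(2) left(3)] by (meson comm_subset)
  next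
    case (right Y1 Y2)
    then show ?thesis using half_of_cover[OF Suc.prems(2) right(3)] by (meson comm_subset)
  qed
  then obtain S1 where S1: "S1 \<subseteq> S" "comm R (c + t) S1 S1" "card S \<le> 2 * card S1" by blast
  then obtain S' where S': "S' \<subseteq> S1" "comm R c S' S'" "card S1 \<le> 2 ^ t * card S'"
    using Suc.IH Suc.prems(2) by (meson finite_subset)
  from S1(3) S'(3) have "card S \<le> 2 ^ Suc t * card S'" by auto
  with S' S1 show ?case by (meson order_trans)
qed

section \<open>Monotone formulas\<close>

datatype 'v mform =
    MVar 'v
  | MConst bool
  | MAnd "'v mform" "'v mform"
  | MOr "'v mform" "'v mform"

primrec meval :: "'v set \<Rightarrow> 'v mform \<Rightarrow> bool" where
  "meval A (MVar v) \<longleftrightarrow> v \<in> A"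
| "meval A (MConst b) \<longleftrightarrow> b"
| "meval A (MAnd f g) \<longleftrightarrow> meval A f \<and> meval A g"
| "meval A (MOr f g) \<longleftrightarrow> meval A f \<or> meval A g"

text \<open>Constants are free, so that replacing a subformula by a constant removes all its leaves.\<close>

primrec mleaves :: "'v mform \<Rightarrow> nat" where
  "mleaves (MVar v) = 1"
| "mleaves (MConst b) = 0"
| "mleaves (MAnd f g) = mleaves f + mleaves g"
| "mleaves (MOr f g) = mleaves f + mleaves g"

lemma mleaves_0: "mleaves f = 0 \<Longrightarrow> (\<forall>A. meval A f) \<or> (\<forall>A. \<not> meval A f)"
  by (induction f) auto

lemma mleaves_le_1:
  "mleaves f \<le> 1 \<Longrightarrow> (\<forall>A. meval A f) \<or> (\<forall>A. \<not> meval A f) \<or> (\<exists>v. \<forall>A. meval A f = (v \<in> A))"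
proof (induction f)
  case (MAnd f g)
  have "mleaves f = 0 \<and> mleaves g \<le> 1 \<or> mleaves g = 0 \<and> mleaves f \<le> 1" using MAnd.prems by auto
  then show ?case
  proof (elim disjE conjE)
    assume "mleaves f = 0" "mleaves g \<le> 1"
    note mleaves_0[OF this(1)] MAnd.IH(2)[OF this(2)]
    then show ?thesis by auto
  next
    assume "mleaves g = 0" "mleaves f \<le> 1"
    note mleaves_0[OF this(1)] MAnd.IH(1)[OF this(2)]
    then show ?thesis by auto
  qed
next
  case (MOr f g)
  have "mleaves f = 0 \<and> mleaves g \<le> 1 \<or> mleaves g = 0 \<and> mleaves f \<le> 1" using MOr.prems by auto
  then show ?case
  proof (elim disjE conjE)
    assume "mleaves f = 0" "mleaves g \<le> 1"
    note mleaves_0[OF this(1)] MOr.IH(2)[OF this(2)]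
    then show ?thesis by auto
  next
    assume "mleaves g = 0" "mleaves f \<le> 1"
    note mleaves_0[OF this(1)] MOr.IH(1)[OF this(2)]
    then show ?thesis by auto
  qed
qed auto

text \<open>As \<open>f\<close> is monotone in its subformula \<open>h\<close>, it amounts to its
  restriction at \<open>h := False\<close>, or else that at \<open>h := True\<close> together with
  \<open>h\<close>; \<open>g0\<close> and \<open>g1\<close> stand for the two restrictions. The last
  clause fits a smallest subformula with at least \<open>t\<close> leaves: its two sides have at
  most \<open>t - 1\<close> each.\<close>

definition msplit :: "nat \<Rightarrow> 'v mform \<Rightarrow> 'v mform \<Rightarrow> 'v mform \<Rightarrow> 'v mform \<Rightarrow> bool" where
  "msplit t f g0 g1 h \<longleftrightarrow> (\<forall>A. meval A f \<longleftrightarrow> meval A g0 \<or> meval A g1 \<and> meval A h) \<and>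
    mleaves g0 + mleaves h \<le> mleaves f \<and> mleaves g1 + mleaves h \<le> mleaves f \<and>
    t \<le> mleaves h \<and> (mleaves h \<le> 1 \<or> mleaves h < 2 * t - 1)"

lemma mform_split:
  assumes "0 < t" "t \<le> mleaves f"
  shows "\<exists>g0 g1 h. msplit t f g0 g1 h"
  using assms(2)
proof (induction f)
  case (MVar v)
  then have "msplit t (MVar v) (MConst False) (MConst True) (MVar v)"
    using assms(1) by (simp add: msplit_def)
  then show ?case by blast
next
  case (MConst b)
  then show ?case using assms(1) by simp
next
  case (MAnd f g)
  consider "t \<le> mleaves f" | "t \<le> mleaves g" | "mleaves f < t" "mleaves g < t" by linarith
  then show ?case
  proof cases
    case 1
    then obtain g0 g1 h where "msplit t f g0 g1 h" using MAnd.IH(1) by blast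
    then have "msplit t (MAnd f g) (MAnd g0 g) (MAnd g1 g) h"
      by (auto simp: msplit_def)
    then show ?thesis by blast
  next
    case 2
    then obtain g0 g1 h where "msplit t g g0 g1 h" using MAnd.IH(2) by blast
    then have "msplit t (MAnd f g) (MAnd f g0) (MAnd f g1) h"
      by (auto simp: msplit_def)
    then show ?thesis by blast
  next
    case 3
    then have "msplit t (MAnd f g) (MConst False) (MConst True) (MAnd f g)"
      using MAnd.prems by (auto simp: msplit_def)
    then show ?thesis by blast
  qed
next
  case (MOr f g)
  consider "t \<le> mleaves f" | "t \<le> mleaves g" | "mleaves f < t" "mleaves g < t" by linarith
  then show ?case
  proof cases
    case 1
    then obtain g0 g1 h where "msplit t f g0 g1 h" using MOr.IH(1) by blast
    \<comment> \<open>\<open>g\<close> is already a disjunct of the new \<open>g0\<close>, so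
      \<open>g1\<close> can do without it.\<close>
    then have "msplit t (MOr f g) (MOr g0 g) g1 h"
      by (auto simp: msplit_def)
    then show ?thesis by blast
  next
    case 2
    then obtain g0 g1 h where "msplit t g g0 g1 h" using MOr.IH(2) by blast
    then have "msplit t (MOr f g) (MOr f g0) g1 h"
      by (auto simp: msplit_def)
    then show ?thesis by blast
  next
    case 3
    then have "msplit t (MOr f g) (MConst False) (MConst True) (MOr f g)"
      using MOr.prems by (auto simp: msplit_def)
    then show ?thesis by blast
  qed
qed

text \<open>The Karchmer-Wigderson simulation of a formula, combined with Spira's balancing: two bits locate
  the inputs relative to a subformula with about a third of the leaves.\<close>

lemma comm_of_mform:
  fixes a :: "'a \<Rightarrow> 'v set" and b :: "'b \<Rightarrow> 'v set"
  assumes R: "\<And>v. \<exists>i. \<forall>x y. v \<in> a x \<and> v \<notin> b y \<longrightarrow> R x y i"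
  assumes "2 ^ d * mleaves f \<le> 3 ^ d"
    and "\<And>x. x \<in> X \<Longrightarrow> meval (a x) f" "\<And>y. y \<in> Y \<Longrightarrow> \<not> meval (b y) f"
  shows "comm R (2 * d) X Y"
  using assms(2-)
proof (induction d arbitrary: f X Y)
  case 0
  then have "mleaves f \<le> 1" by simp
  then have "(\<forall>A. meval A f) \<or> (\<forall>A. \<not> meval A f) \<or> (\<exists>v. \<forall>A. meval A f = (v \<in> A))"
    by (rule mleaves_le_1)
  then show ?case
  proof (elim disjE exE)
    assume "\<forall>A. meval A f"
    then have "Y = {}" using "0.prems" by blast
    then show ?thesis by (auto intro: comm.leaf)
  next
    assume "\<forall>A. \<not> meval A f"
    then have "X = {}" using "0.prems" by blast
    then show ?thesis by (auto intro: comm.leaf)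
  next
    fix v assume v: "\<forall>A. meval A f = (v \<in> A)"
    obtain i where "\<forall>x y. v \<in> a x \<and> v \<notin> b y \<longrightarrow> R x y i" using R by blast
    then show ?thesis using "0.prems" v by (intro comm.leaf[of _ _ _ i]) auto
  qed
next
  case (Suc d)
  show ?case
  proof (cases "mleaves f \<le> 1")
    case True
    then have "2 ^ d * mleaves f \<le> 2 ^ d * 1" by (intro mult_left_mono) auto
    also have "\<dots> \<le> (3::nat) ^ d" by (simp add: power_mono)
    finally have "comm R (2 * d) X Y" using Suc by blast
    then show ?thesis by (rule comm_mono) simp
  next
    case False
    \<comment> \<open>A third of the leaves, rounded up, so that neither \<open>h\<close> nor what
      remains without it has more than two thirds.\<close>
    define t where "t = (mleaves f + 2) div 3"
    have t: "0 < t" "t \<le> mleaves f" using False by (auto simp: t_def)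
    obtain g0 g1 h where "msplit t f g0 g1 h" using mform_split[OF t] by blast
    then have g: "\<And>A. meval A f \<longleftrightarrow> meval A g0 \<or> meval A g1 \<and> meval A h"
      "mleaves g0 + mleaves h \<le> mleaves f" "mleaves g1 + mleaves h \<le> mleaves f"
      "t \<le> mleaves h" "mleaves h \<le> 1 \<or> mleaves h < 2 * t - 1"
      by (simp_all add: msplit_def)
    have size: "2 ^ d * mleaves g \<le> 3 ^ d" if "3 * mleaves g \<le> 2 * mleaves f" for g :: "'v mform"
    proof -
      have "3 * (2 ^ d * mleaves g) = 2 ^ d * (3 * mleaves g)" by simp
      also have "\<dots> \<le> 2 ^ d * (2 * mleaves f)" using that by (rule mult_left_mono) simp
      also have "\<dots> \<le> 3 * 3 ^ d" using Suc.prems(1) by (simp add: algebra_simps)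
      finally show ?thesis by simp
    qed
    have "3 * mleaves g0 \<le> 2 * mleaves f" "3 * mleaves g1 \<le> 2 * mleaves f"
      "3 * mleaves h \<le> 2 * mleaves f"
      using g(2-) False unfolding t_def by linarith+
    note sizes = this[THEN size]
    \<comment> \<open>The first player tells whether \<open>g0\<close> holds. If so,
      \<open>g0\<close> separates the inputs; if not, \<open>g1\<close> and \<open>h\<close> hold at
      \<open>x\<close>, and the second player tells which of them fails at \<open>y\<close>.\<close>
    let ?X = "{x \<in> X. meval (a x) g0}" and ?Y = "{y \<in> Y. meval (b y) g1}"
    have "comm R (2 * d) ?X Y"
      using Suc.prems g(1) by (intro Suc.IH[OF sizes(1)]) auto
    moreover have "comm R (2 * d) (X - ?X) (Y - ?Y)"
      using Suc.prems g(1) by (intro Suc.IH[OF sizes(2)]) auto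
    moreover have "comm R (2 * d) (X - ?X) ?Y"
      using Suc.prems g(1) by (intro Suc.IH[OF sizes(3)]) auto
    ultimately have "comm R (Suc (2 * d)) ?X Y" "comm R (Suc (2 * d)) (X - ?X) Y"
      by (auto intro: comm_mono comm.right[of _ _ "X - ?X" "Y - ?Y" ?Y])
    then have "comm R (Suc (Suc (2 * d))) X Y" by (rule comm.left) auto
    then show ?thesis by simp
  qed
qed

section \<open>Random boxes hit dense sets of words\<close>

definition words :: "nat \<Rightarrow> nat \<Rightarrow> nat list set" where
  "words w l = {x. set x \<subseteq> {..<w} \<and> length x = l}"

lemma finite_words [simp]: "finite (words w l)"
  by (simp add: words_def finite_lists_length_eq)

lemma card_words: "card (words w l) = w ^ l"
  by (simp add: words_def card_lists_length_eq)

lemma words_0: "words w 0 = {[]}"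
  by (auto simp: words_def)

definition boxes :: "nat \<Rightarrow> nat \<Rightarrow> nat set list set" where
  "boxes w m = {As. set As \<subseteq> Pow {..<w} \<and> length As = m}"

lemma finite_boxes [simp]: "finite (boxes w m)"
  by (simp add: boxes_def finite_lists_length_eq)

lemma card_boxes: "card (boxes w m) = (2 ^ w) ^ m"
  by (simp add: boxes_def card_lists_length_eq card_Pow)

definition missing :: "nat \<Rightarrow> nat \<Rightarrow> nat list set \<Rightarrow> nat set list set" where
  "missing w m V = {As \<in> boxes w m. \<forall>v\<in>V. \<not> list_all2 (\<in>) v As}"

lemma finite_missing [simp]: "finite (missing w m V)"
  by (simp add: missing_def)

lemma card_words_fibres:
  assumes "V \<subseteq> words w (Suc m)"
  shows "card V = (\<Sum>a<w. card {v. a # v \<in> V})"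
proof -
  have eq: "V = (\<Union>a<w. (#) a ` {v. a # v \<in> V})"
  proof (intro equalityI subsetI)
    fix x assume x: "x \<in> V"
    with assms obtain a v where "x = a # v" "a < w" by (cases x) (auto simp: words_def)
    with x show "x \<in> (\<Union>a<w. (#) a ` {v. a # v \<in> V})" by auto
  qed auto
  have fin: "finite {v. a # v \<in> V}" for a
    using finite_subset[OF assms] finite_imageD[of "(#) a" "{v. a # v \<in> V}"]
    by (smt (verit, best) finite_subset finite_words image_subsetI inj_on_def list.inject mem_Collect_eq)
  have "card V = card (\<Union>a<w. (#) a ` {v. a # v \<in> V})" using eq by simp
  also have "\<dots> = (\<Sum>a<w. card ((#) a ` {v. a # v \<in> V}))"
    using fin by (intro card_UN_disjoint) auto
  also have "\<dots> = (\<Sum>a<w. card {v. a # v \<in> V})" by (simp add: card_image)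
  finally show ?thesis .
qed

text \<open>Dense fibres are so numerous that a random subset of the alphabet contains the first letter of
  one of them, except with probability \<open>2 ^ - k\<close>. The \<open>m\<close> letters together cost a density of at
  most \<open>m k / w\<close>.\<close>

lemma card_missing:
  assumes "V \<subseteq> words w m" "m * k * w ^ m < w * card V"
  shows "2 ^ k * card (missing w m V) \<le> m * (2 ^ w) ^ m"
  using assms
proof (induction m arbitrary: V)
  case 0
  then have "V = {[]}" by (auto simp: words_0 subset_singleton_iff)
  then show ?case by (simp add: missing_def boxes_def)
next
  case (Suc m)
  let ?F = "\<lambda>a. {v. a # v \<in> V}"
  define H where "H = {a \<in> {..<w}. m * k * w ^ m < w * card (?F a)}"
  have F: "?F a \<subseteq> words w m" for a using Suc.prems(1) by (fastforce simp: words_def)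
  have [simp]: "finite H" by (simp add: H_def)
  have "w * (Suc m * k * w ^ m) < w * card V" using Suc.prems(2) by (simp add: algebra_simps)
  then have "w * (Suc m * k * w ^ m) < w * (\<Sum>a<w. card (?F a))"
    using card_words_fibres[OF Suc.prems(1)] by simp
  also have "\<dots> = (\<Sum>a<w. w * card (?F a))" by (simp add: sum_distrib_left)
  \<comment> \<open>Fibres outside \<open>H\<close> have density at most \<open>m * k / w\<close>,
    so the surplus \<open>k / w\<close> of \<open>V\<close> must come from more than
    \<open>k\<close> letters in \<open>H\<close>.\<close>
  also have "\<dots> \<le> (\<Sum>a<w. (if a \<in> H then w * w ^ m else 0) + m * k * w ^ m)"
  proof (rule sum_mono)
    fix a assume "a \<in> {..<w}"
    moreover have "card (?F a) \<le> w ^ m" using card_mono[OF _ F] by (simp add: card_words)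
    ultimately show "w * card (?F a) \<le> (if a \<in> H then w * w ^ m else 0) + m * k * w ^ m"
      by (auto simp: H_def intro: trans_le_add1)
  qed
  also have "\<dots> = w * (card H * w ^ m + m * k * w ^ m)"
  proof -
    have "{..<w} \<inter> H = H" by (auto simp: H_def)
    then show ?thesis by (simp add: sum.distrib sum.If_cases algebra_simps)
  qed
  finally have "Suc m * k * w ^ m < card H * w ^ m + m * k * w ^ m" by simp
  then have "k * w ^ m < card H * w ^ m" by (simp only: mult_Suc distrib_right)
  then have kH: "k \<le> card H" by simp
  define h where "h A = (SOME a. a \<in> A \<inter> H)" for A
  have h: "h A \<in> A \<inter> H" if "A \<inter> H \<noteq> {}" for A
    unfolding h_def using that by (metis ex_in_conv someI)
  \<comment> \<open>A box missing \<open>V\<close> has a first set disjoint from \<open>H\<close>,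
    or its other sets miss the dense fibre of \<open>h A\<close>. These events have probability at
    most \<open>2 ^ - k\<close> and \<open>m\<close> times this.\<close>
  let ?M1 = "(\<lambda>(A, As). A # As) ` (Pow ({..<w} - H) \<times> boxes w m)"
  let ?M2 = "(\<lambda>(A, As). A # As) ` (SIGMA A:{A \<in> Pow {..<w}. A \<inter> H \<noteq> {}}. missing w m (?F (h A)))"
  have "missing w (Suc m) V \<subseteq> ?M1 \<union> ?M2"
  proof
    fix B assume B: "B \<in> missing w (Suc m) V"
    then obtain A As where BA: "B = A # As" by (cases B) (auto simp: missing_def boxes_def)
    have A: "A \<subseteq> {..<w}" "As \<in> boxes w m" using B BA by (auto simp: missing_def boxes_def)
    show "B \<in> ?M1 \<union> ?M2"
    proof (cases "A \<inter> H = {}")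
      case True
      then show ?thesis using A BA by (auto simp: image_iff)
    next
      case False
      have "As \<in> missing w m (?F (h A))"
        using B BA A h[OF False] by (fastforce simp: missing_def)
      then show ?thesis using A BA False by (auto simp: image_iff)
    qed
  qed
  then have "card (missing w (Suc m) V) \<le> card (?M1 \<union> ?M2)"
    by (intro card_mono) auto
  also have "\<dots> \<le> card ?M1 + card ?M2" by (rule card_Un_le)
  also have "card ?M1 \<le> card (Pow ({..<w} - H) \<times> boxes w m)" by (rule card_image_le) auto
  also have "card ?M2 \<le> card (SIGMA A:{A \<in> Pow {..<w}. A \<inter> H \<noteq> {}}. missing w m (?F (h A)))"
    by (rule card_image_le) auto
  finally have "card (missing w (Suc m) V) \<le> card (Pow ({..<w} - H) \<times> boxes w m) +
      card (SIGMA A:{A \<in> Pow {..<w}. A \<inter> H \<noteq> {}}. missing w m (?F (h A)))" by simp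
  moreover have "2 ^ k * card (Pow ({..<w} - H) \<times> boxes w m) \<le> 2 ^ w * (2 ^ w) ^ m"
  proof -
    have Hw: "H \<subseteq> {..<w}" by (auto simp: H_def)
    have "card ({..<w} - H) = w - card H" "card H \<le> w"
      using Hw card_Diff_subset[of H "{..<w}"] card_mono[OF _ Hw] by auto
    then have "2 ^ k * 2 ^ card ({..<w} - H) \<le> (2::nat) ^ w"
      using kH by (simp flip: power_add)
    then show ?thesis by (simp add: card_cartesian_product card_Pow card_boxes flip: mult.assoc)
  qed
  moreover have "2 ^ k * card (SIGMA A:{A \<in> Pow {..<w}. A \<inter> H \<noteq> {}}. missing w m (?F (h A)))
      \<le> 2 ^ w * (m * (2 ^ w) ^ m)"
  proof -
    let ?P = "{A \<in> Pow {..<w}. A \<inter> H \<noteq> {}}"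
    have "2 ^ k * card (SIGMA A:?P. missing w m (?F (h A)))
        = (\<Sum>A\<in>?P. 2 ^ k * card (missing w m (?F (h A))))"
      by (subst card_SigmaI) (auto simp: sum_distrib_left)
    also have "\<dots> \<le> (\<Sum>A\<in>?P. m * (2 ^ w) ^ m)"
    proof (rule sum_mono)
      fix A assume "A \<in> ?P"
      then have "h A \<in> H" using h by auto
      then show "2 ^ k * card (missing w m (?F (h A))) \<le> m * (2 ^ w) ^ m"
        by (intro Suc.IH F) (auto simp: H_def)
    qed
    also have "\<dots> = card ?P * (m * (2 ^ w) ^ m)" by simp
    also have "card ?P \<le> card (Pow {..<w})" by (rule card_mono) auto
    finally show ?thesis by (simp add: card_Pow)
  qed
  ultimately have "2 ^ k * card (missing w (Suc m) V) \<le> 2 ^ w * (2 ^ w) ^ m + 2 ^ w * (m * (2 ^ w) ^ m)"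
    by (rule order_trans[OF mult_le_mono2, OF _ order_trans[OF eq_refl[OF distrib_left] add_mono]])
  then show ?case by (simp add: algebra_simps)
qed

section \<open>The fork game\<close>

text \<open>The words are extended by a common letter \<open>0\<close> in front and by two distinct letters at the end, so
  that the last position is a fork as soon as the letters there agree.\<close>

definition fork :: "nat list \<Rightarrow> nat list \<Rightarrow> nat \<Rightarrow> bool" where
  "fork x y i \<longleftrightarrow> i \<le> length x \<and> (0 # x) ! i = (0 # y) ! i \<and> (i < length x \<longrightarrow> x ! i \<noteq> y ! i)"

text \<open>Next letters agree inside the common prefix, so no fork lies there; a fork right behind
  it survives thanks to the common leading \<open>0\<close>.\<close>

lemma fork_appendD_left:
  assumes "fork (u @ v) (u @ v') i" "length v = length v'"
  shows "fork v v' (i - length u)"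
proof -
  have "\<not> i < length u" using assms by (auto simp: fork_def nth_append)
  then obtain j where i: "i = length u + j" by (metis le_Suc_ex not_less)
  show ?thesis
    using assms unfolding i by (cases j) (auto simp: fork_def nth_append)
qed

text \<open>Letters before a fork agree, so it lies no further than \<open>length u\<close>; there
  \<open>u\<close> and \<open>u'\<close> end and no differing letters are required.\<close>

lemma fork_appendD_right:
  assumes "fork (u @ v) (u' @ v') i" "length u = length u'" "length v = length v'"
    and "\<And>j. j < length v \<Longrightarrow> v ! j \<noteq> v' ! j"
  shows "fork u u' i"
proof (cases "i \<le> length u")
  case True
  then show ?thesis
    using assms(1,2) by (cases i) (auto simp: fork_def nth_append split: if_splits)
next
  case False
  then obtain j where i: "i = Suc (length u + j)" by (metis add_Suc_right less_imp_Suc_add not_less)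
  have "j < length v" using assms(1) by (auto simp: fork_def i)
  moreover have "v ! j = v' ! j" using assms(1,2) by (simp add: fork_def i nth_append)
  ultimately show ?thesis using assms(4) by blast
qed

section \<open>Complementary boxes\<close>

definition box_compl :: "nat \<Rightarrow> nat set list \<Rightarrow> nat set list" where
  "box_compl w = map (\<lambda>A. {..<w} - A)"

lemma box_compl_in_boxes: "As \<in> boxes w m \<Longrightarrow> box_compl w As \<in> boxes w m"
  by (auto simp: boxes_def box_compl_def)

lemma box_compl_inverse: "As \<in> boxes w m \<Longrightarrow> box_compl w (box_compl w As) = As"
  by (fastforce simp: boxes_def box_compl_def intro!: map_idI)

lemma card_missing_compl:
  "card {As \<in> boxes w m. box_compl w As \<in> missing w m V} \<le> card (missing w m V)"
proof (rule card_inj_on_le)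
  show "inj_on (box_compl w) {As \<in> boxes w m. box_compl w As \<in> missing w m V}"
    by (rule inj_on_inverseI[where g = "box_compl w"]) (auto simp: box_compl_inverse)
qed auto

lemma box_separates:
  assumes "list_all2 (\<in>) v As" "list_all2 (\<in>) v' (box_compl w As)" "j < length v"
  shows "v ! j \<noteq> v' ! j"
  using assms by (auto simp: list_all2_conv_all_nth box_compl_def)

text \<open>For each \<open>u\<close>, a random box and its complement fail with probability at most
  \<open>m / 2 ^ k\<close> each, hence at most one quarter. So half of the boxes serve
  \<open>u\<close>, and by double counting some box serves half of \<open>G\<close>.\<close>

lemma exists_box_hitting_half:
  assumes G: "finite G" "\<And>u. u \<in> G \<Longrightarrow> V u \<subseteq> words w m"
    and big: "\<And>u. u \<in> G \<Longrightarrow> m * k * w ^ m < w * card (V u)"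
    and k: "4 * m \<le> 2 ^ k"
  shows "\<exists>As\<in>boxes w m. card G \<le> 2 * card {u \<in> G. As \<notin> missing w m (V u) \<and>
    box_compl w As \<notin> missing w m (V u)}"
proof (rule ccontr)
  let ?B = "boxes w m"
  define bad where "bad u = {As \<in> ?B. As \<in> missing w m (V u) \<or> box_compl w As \<in> missing w m (V u)}" for u
  let ?ok = "\<lambda>As. {u \<in> G. As \<notin> missing w m (V u) \<and> box_compl w As \<notin> missing w m (V u)}"
  assume "\<not> ?thesis"
  then have less: "2 * card (?ok As) < card G" if "As \<in> ?B" for As using that by force
  have B: "?B \<noteq> {}"
  proof -
    have "card ?B \<noteq> 0" by (simp add: card_boxes)
    then show ?thesis by auto
  qed
  have bad: "2 * card (bad u) \<le> card ?B" if u: "u \<in> G" for u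
  proof -
    have "bad u \<subseteq> missing w m (V u) \<union> {As \<in> ?B. box_compl w As \<in> missing w m (V u)}"
      by (auto simp: bad_def)
    then have "card (bad u) \<le> card (missing w m (V u) \<union> {As \<in> ?B. box_compl w As \<in> missing w m (V u)})"
      by (intro card_mono) auto
    also have "\<dots> \<le> card (missing w m (V u)) + card {As \<in> ?B. box_compl w As \<in> missing w m (V u)}"
      by (rule card_Un_le)
    also have "\<dots> \<le> 2 * card (missing w m (V u))" using card_missing_compl[of w m "V u"] by simp
    finally have 1: "card (bad u) \<le> 2 * card (missing w m (V u))" .
    have "2 ^ k * (2 * card (bad u)) \<le> 4 * (2 ^ k * card (missing w m (V u)))"
      using 1 by simp
    also have "\<dots> \<le> 4 * (m * card ?B)"
      using card_missing[OF G(2) big, OF u u] by (simp add: card_boxes)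
    also have "\<dots> \<le> 2 ^ k * card ?B" using k by simp
    finally show ?thesis by simp
  qed
  have "(\<Sum>As\<in>?B. card G) \<le> (\<Sum>As\<in>?B. card (?ok As) + card {u \<in> G. As \<in> bad u})"
  proof (rule sum_mono)
    fix As assume As: "As \<in> ?B"
    have "G = ?ok As \<union> {u \<in> G. As \<in> bad u}" using As by (auto simp: bad_def)
    then show "card G \<le> card (?ok As) + card {u \<in> G. As \<in> bad u}"
      by (metis (no_types, lifting) card_Un_le)
  qed
  also have "\<dots> = (\<Sum>As\<in>?B. card (?ok As)) + (\<Sum>As\<in>?B. card {u \<in> G. As \<in> bad u})"
    by (rule sum.distrib)
  also have "(\<Sum>As\<in>?B. card {u \<in> G. As \<in> bad u}) = (\<Sum>u\<in>G. card {As \<in> ?B. As \<in> bad u})"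
    using G(1) by (intro sum_multicount_gen) auto
  also have "\<dots> = (\<Sum>u\<in>G. card (bad u))"
    by (intro sum.cong refl arg_cong[where f = card]) (auto simp: bad_def)
  finally have 1: "card ?B * card G \<le> (\<Sum>As\<in>?B. card (?ok As)) + (\<Sum>u\<in>G. card (bad u))" by simp
  have 2: "2 * (\<Sum>u\<in>G. card (bad u)) \<le> card G * card ?B"
    using sum_bounded_above[of G "\<lambda>u. 2 * card (bad u)" "card ?B"] bad
    by (simp add: sum_distrib_left)
  have "(\<Sum>As\<in>?B. 2 * card (?ok As)) < (\<Sum>As\<in>?B. card G)"
    using less B by (intro sum_strict_mono) auto
  then have 3: "2 * (\<Sum>As\<in>?B. card (?ok As)) < card ?B * card G" by (simp add: sum_distrib_left)
  show False using 1 2 3 by (simp add: mult.commute)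
qed

lemma card_words_append_fibres:
  assumes "S \<subseteq> words w (m + n)"
  shows "card S = (\<Sum>u\<in>words w m. card {v. u @ v \<in> S})"
proof -
  have fin: "finite {v. u @ v \<in> S}" for u
    by (rule finite_subset[of _ "drop (length u) ` S"])
      (auto simp: image_iff intro!: finite_subset[OF assms] bexI[of _ "u @ _"])
  have "S = (\<lambda>(u, v). u @ v) ` (SIGMA u:words w m. {v. u @ v \<in> S})"
  proof (intro equalityI subsetI)
    fix x assume x: "x \<in> S"
    then have "x \<in> words w (m + n)" using assms by blast
    then have "take m x \<in> words w m" using set_take_subset[of m x] by (auto simp: words_def)
    then show "x \<in> (\<lambda>(u, v). u @ v) ` (SIGMA u:words w m. {v. u @ v \<in> S})"
      using x by (intro image_eqI[of _ _ "(take m x, drop m x)"]) auto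
  qed auto
  moreover have "inj_on (\<lambda>(u, v). u @ v) (SIGMA u:words w m. {v. u @ v \<in> S})"
    by (auto simp: inj_on_def words_def)
  ultimately have "card S = card (SIGMA u:words w m. {v. u @ v \<in> S})" by (metis card_image)
  then show ?thesis using fin by simp
qed

text \<open>The amplification step: either one prefix has many continuations in \<open>S\<close>, or many prefixes have
  sufficiently many. In the second case the players extend their prefixes inside complementary
  boxes, so that the fork they find must lie in the first half.\<close>

lemma fork_amplify:
  assumes r: "2 \<le> r" and m: "m \<le> 2 ^ r" and w: "w = 2 ^ (8 * r)"
    and S: "S \<subseteq> words w (m + m)" "comm fork c S S"
    and dense: "w ^ (m + m) \<le> 2 ^ (3 * r) * card S"
  shows "\<exists>S'\<subseteq>words w m. comm fork c S' S' \<and> w ^ m \<le> 2 ^ (2 * r) * card S'"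
proof -
  define V where "V u = {v. u @ v \<in> S}" for u
  have V: "V u \<subseteq> words w m" if "u \<in> words w m" for u
    using S(1) that by (fastforce simp: V_def words_def)
  show ?thesis
  proof (cases "\<exists>u\<in>words w m. w ^ m \<le> 2 ^ (2 * r) * card (V u)")
    case True
    then obtain u where u: "u \<in> words w m" "w ^ m \<le> 2 ^ (2 * r) * card (V u)" by blast
    have "fork v v' (i - length u)" if "v \<in> V u" "v' \<in> V u" "fork (u @ v) (u @ v') i" for v v' i
      using that V[OF u(1)] by (intro fork_appendD_left) (auto simp: words_def)
    then have "comm fork c (V u) (V u)"
      using S(2) by (intro comm_simulate[of fork c S S "(@) u" "V u" "(@) u" "V u" fork "\<lambda>i. i - length u"])
        (auto simp: V_def)
    then show ?thesis using u V by blast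
  next
    case False
    \<comment> \<open>Prefixes with at least half the average density that \<open>dense\<close>
      guarantees. As no fibre reaches density \<open>2 ^ - (2 * r)\<close>, averaging gives
      \<open>G\<close> density at least \<open>2 ^ - (r + 1)\<close>.\<close>
    define G where "G = {u \<in> words w m. w ^ m \<le> 2 ^ (3 * r + 1) * card (V u)}"
    have [simp]: "finite G" and GW: "G \<subseteq> words w m" by (auto simp: G_def)
    have "2 * (w ^ m * w ^ m) \<le> 2 ^ (3 * r + 1) * card S"
      using dense by (simp add: power_add)
    also have "\<dots> = (\<Sum>u\<in>words w m. 2 ^ (3 * r + 1) * card (V u))"
      unfolding card_words_append_fibres[OF S(1)] V_def by (rule sum_distrib_left)
    also have "\<dots> \<le> (\<Sum>u\<in>words w m. (if u \<in> G then 2 ^ (r + 1) * w ^ m else 0) + w ^ m)"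
    proof (rule sum_mono)
      fix u assume u: "u \<in> words w m"
      then have "2 ^ (r + 1) * (2 ^ (2 * r) * card (V u)) \<le> 2 ^ (r + 1) * w ^ m"
        using False by (intro mult_le_mono2) (auto simp: not_le)
      then have "2 ^ (3 * r + 1) * card (V u) \<le> 2 ^ (r + 1) * w ^ m"
        by (simp add: mult.assoc[symmetric] power_add[symmetric])
      then show "2 ^ (3 * r + 1) * card (V u) \<le> (if u \<in> G then 2 ^ (r + 1) * w ^ m else 0) + w ^ m"
        using u by (simp add: G_def)
    qed
    also have "\<dots> = card G * (2 ^ (r + 1) * w ^ m) + w ^ m * w ^ m"
      using GW by (simp add: sum.distrib sum.If_cases card_words Int_absorb1)
    finally have "w ^ m * w ^ m \<le> (2 ^ (r + 1) * card G) * w ^ m" by (simp add: mult_ac)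
    moreover have "0 < w ^ m" by (simp add: w)
    ultimately have G: "w ^ m \<le> 2 ^ (r + 1) * card G" by (simp only: mult_le_cancel2)
    \<comment> \<open>The alphabet is large enough for \<open>card_missing\<close> with
      \<open>k = r + 2\<close> in fibres of density \<open>2 ^ - (3 * r + 1)\<close>.\<close>
    have small: "2 ^ (3 * r + 1) * (m * (r + 2)) < w"
    proof -
      have "m * (r + 2) \<le> 2 ^ r * (r + 2)" using m by (rule mult_le_mono1)
      also have "\<dots> < 2 ^ r * 2 ^ (r + 2)" using less_exp[of "r + 2"] by (simp only: mult_less_cancel1) simp
      finally have "m * (r + 2) < 2 ^ r * 2 ^ (r + 2)" .
      then have "2 ^ (3 * r + 1) * (m * (r + 2)) < 2 ^ (3 * r + 1) * (2 ^ r * 2 ^ (r + 2))"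
        by (simp only: mult_less_cancel1) simp
      also have "\<dots> = (2::nat) ^ ((3 * r + 1) + (r + (r + 2)))" by (simp only: power_add)
      also have "\<dots> \<le> w" unfolding w using r by (intro power_increasing) linarith+
      finally show ?thesis .
    qed
    have big: "m * (r + 2) * w ^ m < w * card (V u)" if "u \<in> G" for u
    proof -
      have "2 ^ (3 * r + 1) * (m * (r + 2)) * w ^ m < w * w ^ m"
        using small \<open>0 < w ^ m\<close> by (intro mult_strict_right_mono)
      also have "\<dots> \<le> w * (2 ^ (3 * r + 1) * card (V u))"
        using that by (intro mult_le_mono2) (simp add: G_def)
      finally have "2 ^ (3 * r + 1) * (m * (r + 2) * w ^ m) < 2 ^ (3 * r + 1) * (w * card (V u))"
        by (simp only: ac_simps)
      then show ?thesis by (simp only: mult_less_cancel1)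
    qed
    have "4 * m \<le> 2 ^ (r + 2)" using m by simp
    then obtain As where As: "As \<in> boxes w m"
      and half: "card G \<le> 2 * card {u \<in> G. As \<notin> missing w m (V u) \<and> box_compl w As \<notin> missing w m (V u)}"
      using exists_box_hitting_half[of G V w m "r + 2"] big V GW by auto
    define S' where "S' = {u \<in> G. As \<notin> missing w m (V u) \<and> box_compl w As \<notin> missing w m (V u)}"
    have "\<forall>u\<in>S'. \<exists>v. v \<in> V u \<and> list_all2 (\<in>) v As"
      using As by (auto simp: S'_def missing_def)
    then obtain f where f: "\<And>u. u \<in> S' \<Longrightarrow> f u \<in> V u" "\<And>u. u \<in> S' \<Longrightarrow> list_all2 (\<in>) (f u) As"
      by metis
    have "\<forall>u\<in>S'. \<exists>v. v \<in> V u \<and> list_all2 (\<in>) v (box_compl w As)"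
      using box_compl_in_boxes[OF As] by (auto simp: S'_def missing_def)
    then obtain g where g: "\<And>u. u \<in> S' \<Longrightarrow> g u \<in> V u"
      "\<And>u. u \<in> S' \<Longrightarrow> list_all2 (\<in>) (g u) (box_compl w As)"
      by metis
    have S'W: "S' \<subseteq> words w m" using GW by (auto simp: S'_def)
    have "comm fork c S' S'"
    proof (rule comm_simulate[OF S(2), where f = "\<lambda>u. u @ f u" and g = "\<lambda>u. u @ g u" and h = id])
      fix u u' i assume u: "u \<in> S'" "u' \<in> S'" and fk: "fork (u @ f u) (u' @ g u') i"
      have len: "length u = m" "length u' = m" "length (f u) = m" "length (g u') = m"
        using u S'W V[of u] V[of u'] f(1)[of u] g(1)[of u'] by (auto simp: words_def)
      show "fork u u' (id i)"
        using fork_appendD_right[OF fk] box_separates[OF f(2) g(2)] u len by simp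
    qed (use f(1) g(1) in \<open>auto simp: V_def\<close>)
    moreover have "w ^ m \<le> 2 ^ (2 * r) * card S'"
    proof -
      \<comment> \<open>In the exponent, \<open>r + 1\<close> from passing to \<open>G\<close> and
        one more from halving it fit into \<open>2 * r\<close>, as \<open>2 \<le> r\<close>.\<close>
      have "w ^ m \<le> 2 ^ (r + 1) * (2 * card S')"
        unfolding S'_def by (rule order_trans[OF G mult_le_mono2[OF half]])
      also have "\<dots> = 2 ^ (r + 2) * card S'" by simp
      also have "\<dots> \<le> 2 ^ (2 * r) * card S'"
        using r by (intro mult_le_mono1 power_increasing) auto
      finally show ?thesis .
    qed
    ultimately show ?thesis using S'W by blast
  qed
qed

text \<open>Each of \<open>p\<close> phases spends \<open>r\<close> bits, lowering the density from
  \<open>2 ^ - (2 * r)\<close> to \<open>2 ^ - (3 * r)\<close>; amplification then restores it for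
  words of half the length. At length one no bits remain, and an answer fixed in advance allows only
  a single word, too few for the density.\<close>

lemma fork_dense_lower_bound:
  assumes r: "2 \<le> r" and w: "w = 2 ^ (8 * r)" and "p \<le> r"
    and "S \<subseteq> words w (2 ^ p)" "w ^ 2 ^ p \<le> 2 ^ (2 * r) * card S"
  shows "\<not> comm fork (p * r) S S"
  using assms(3-)
proof (induction p arbitrary: S)
  case 0
  show ?case
  proof
    assume "comm fork (0 * r) S S"
    then obtain i where i: "\<And>x y. x \<in> S \<Longrightarrow> y \<in> S \<Longrightarrow> fork x y i"
      using comm_0 by fastforce
    have "x = y" if "x \<in> S" "y \<in> S" for x y
    proof -
      have "length x = 1" "length y = 1" using that 0 by (auto simp: words_def)
      \<comment> \<open>The pair \<open>x\<close>, \<open>x\<close> excludes position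
        \<open>0\<close>; at position \<open>1\<close>, a fork of \<open>x\<close> and
        \<open>y\<close> makes their only letters agree.\<close>
      moreover have "fork x x i" "fork x y i" using i that by auto
      ultimately have "x ! 0 = y ! 0" by (cases i) (auto simp: fork_def)
      with \<open>length x = 1\<close> \<open>length y = 1\<close> show ?thesis by (intro nth_equalityI) auto
    qed
    then have "card S \<le> 1"
      by (metis card.infinite card_le_Suc0_iff_eq One_nat_def zero_le)
    then have "w \<le> 2 ^ (2 * r)" using 0 order_trans[of w "2 ^ (2 * r) * card S" "2 ^ (2 * r) * 1"]
      by (simp del: mult_1_right add: mult_le_mono2) 
    then show False using r by (simp add: w)
  qed
next
  case (Suc p)
  show ?case
  proof
    assume "comm fork (Suc p * r) S S"
    then have "comm fork (p * r + r) S S" by (simp add: add.commute)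
    moreover have "finite S" using finite_subset[OF Suc.prems(2)] by simp
    ultimately obtain S1 where S1: "S1 \<subseteq> S" "comm fork (p * r) S1 S1" "card S \<le> 2 ^ r * card S1"
      using comm_halve[of fork "p * r" r S] by blast
    have two: "(2::nat) ^ Suc p = 2 ^ p + 2 ^ p" by simp
    have "w ^ (2 ^ p + 2 ^ p) \<le> 2 ^ (2 * r) * card S" using Suc.prems(3) unfolding two .
    also have "\<dots> \<le> 2 ^ (2 * r) * (2 ^ r * card S1)" using S1(3) by (rule mult_le_mono2)
    also have "\<dots> = 2 ^ (3 * r) * card S1" by (simp add: mult.assoc[symmetric] power_add[symmetric])
    finally have "w ^ (2 ^ p + 2 ^ p) \<le> 2 ^ (3 * r) * card S1" .
    moreover have "(2::nat) ^ p \<le> 2 ^ r" using Suc.prems(1) by (intro power_increasing) auto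
    moreover have "S1 \<subseteq> words w (2 ^ p + 2 ^ p)" using S1(1) Suc.prems(2) unfolding two by blast
    ultimately obtain S' where "S' \<subseteq> words w (2 ^ p)" "comm fork (p * r) S' S'"
      "w ^ 2 ^ p \<le> 2 ^ (2 * r) * card S'"
      using fork_amplify[OF r _ w, of "2 ^ p" S1] S1(2) by blast
    then show False using Suc.IH Suc.prems(1) by auto
  qed
qed

lemma fork_lower_bound:
  assumes "2 \<le> r"
  shows "\<not> comm fork (r * r) (words (2 ^ (8 * r)) (2 ^ r)) (words (2 ^ (8 * r)) (2 ^ r))"
  using assms by (intro fork_dense_lower_bound) (auto simp: card_words)

section \<open>Cuts as answers to a query over a star-shaped ontology\<close>

text \<open>The unary predicates \<open>0\<close> and \<open>1\<close> create a null with edges into, respectively out of, the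
  constant; \<open>2\<close> marks nulls of the first kind. Node variables are only sources and edge variables only
  targets of query edges. A node variable sent to the first null says that the node lies in the cut
  set \<open>X\<close>. For \<open>e = (u, v)\<close>, no query edge can join two nulls, and \<open>req e\<close> holds at the constant
  itself only if \<open>e\<close> is switched off; otherwise exactly one of \<open>node_var v\<close> and \<open>edge_var e\<close> is sent to a
  null, and hence \<open>u \<in> X\<close> forces \<open>v \<in> X\<close>.\<close>

definition req :: "nat \<times> nat \<Rightarrow> pred" where
  "req e = Suc (prod_encode e)"

definition node_var :: "nat \<Rightarrow> var" where
  "node_var u = 2 * u"

definition edge_var :: "nat \<times> nat \<Rightarrow> var" where
  "edge_var e = Suc (2 * prod_encode e)"

lemma req_simps [simp]: "req e = req e' \<longleftrightarrow> e = e'" "req e \<noteq> 0" "0 \<noteq> req e"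
  by (auto simp: req_def)

lemma var_simps [simp]:
  "node_var u = node_var v \<longleftrightarrow> u = v" "edge_var e = edge_var e' \<longleftrightarrow> e = e'"
  "node_var u \<noteq> edge_var e" "edge_var e \<noteq> node_var u"
  unfolding node_var_def edge_var_def by (simp_all add: Suc_double_not_eq_double double_not_eq_Suc_double)

definition role_preds :: "(nat \<times> nat) list \<Rightarrow> pred list" where
  "role_preds E = 0 # map req E"

definition tgd_in :: "(nat \<times> nat) list \<Rightarrow> tgd" where
  "tgd_in E = Tgd (Unary 0 0) (Unary 2 1 # map (\<lambda>P. Binary P 1 0) (role_preds E))"

definition tgd_out :: "(nat \<times> nat) list \<Rightarrow> tgd" where
  "tgd_out E = Tgd (Unary 1 0) (map (\<lambda>P. Binary P 0 1) (role_preds E))"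

definition star_ontology :: "(nat \<times> nat) list \<Rightarrow> tgd set" where
  "star_ontology E = {tgd_in E, tgd_out E}"

definition cut_query :: "nat \<Rightarrow> nat \<Rightarrow> (nat \<times> nat) list \<Rightarrow> cq" where
  "cut_query s t E = CQ [] (Unary 2 (node_var s) # Unary 0 (node_var t) #
    map (\<lambda>e. Binary 0 (node_var (fst e)) (edge_var e)) E @
    map (\<lambda>e. Binary (req e) (node_var (snd e)) (edge_var e)) E)"

text \<open>\<open>p\<close> holds the switched-off edges: for these, the loop \<open>req e\<close>
  lets the target node and the edge variable of \<open>e\<close> both be sent to the
  constant.\<close>

definition point_instance :: "(nat \<times> nat) list \<Rightarrow> (nat \<times> nat) set \<Rightarrow> nat atom set" where
  "point_instance E p = {Unary 0 0, Unary 1 0, Binary 0 0 0} \<union> (\<lambda>e. Binary (req e) 0 0) ` (set E \<inter> p)"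

text \<open>The canonical model up to renaming: \<open>0\<close> is the constant, \<open>1\<close>
  the null with edges into it, \<open>2\<close> the null with edges out of it.\<close>

definition star_model :: "(nat \<times> nat) list \<Rightarrow> (nat \<times> nat) set \<Rightarrow> nat atom set" where
  "star_model E p = point_instance E p \<union> {Unary 2 1} \<union>
    (\<lambda>P. Binary P 1 0) ` set (role_preds E) \<union> (\<lambda>P. Binary P 0 2) ` set (role_preds E)"

section \<open>Well-formedness and depth\<close>

lemma wf_cut_query: "wf_cq (cut_query s t E)"
  by (simp add: wf_cq_def cut_query_def)

lemma ontology_star_ontology: "ontology (star_ontology E)"
proof -
  have "tgd_vars \<sigma> \<subseteq> {0, 1}" if "\<sigma> \<in> star_ontology E" for \<sigma>
    using that by (auto simp: star_ontology_def tgd_in_def tgd_out_def tgd_vars_def tgd_atoms_def)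
  then have "card (tgd_vars \<sigma>) \<le> 2" if "\<sigma> \<in> star_ontology E" for \<sigma>
    using card_mono[of "{0, 1}" "tgd_vars \<sigma>"] that by simp
  then show ?thesis
    by (auto simp: ontology_def star_ontology_def tgd_in_def tgd_out_def role_preds_def)
qed

lemma unary_preds_star_ontology: "unary_preds (star_ontology E) = {0, 1, 2}"
  by (auto simp: unary_preds_def star_ontology_def tgd_in_def tgd_out_def tgd_atoms_def)

lemma zero_in_binary_preds: "0 \<in> binary_preds (star_ontology E)"
  by (auto simp: binary_preds_def star_ontology_def tgd_out_def tgd_atoms_def role_preds_def)

text \<open>The ontology derives neither \<open>Unary 0\<close> nor \<open>Unary 1\<close>, so these
  hold at most at the root and never both. Hence at most one of its two tgds fires, and all edges
  enter the root or all leave it.\<close>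

lemma root_model_edges:
  assumes "C \<in> root_models (star_ontology E)"
  shows "\<exists>c. (\<forall>R x y. Binary R x y \<in> C \<longrightarrow> y = c) \<or> (\<forall>R x y. Binary R x y \<in> C \<longrightarrow> x = c)"
proof -
  obtain P \<rho> a where C: "C = chase (insert (Tgd (Unary P 0) [\<rho>]) (star_ontology E)) {Unary P a}"
    and P: "P \<noteq> 0" "P \<noteq> 1" "P \<noteq> 2" and \<rho>: "\<rho> \<in> root_atoms (star_ontology E)"
    using assms by (auto simp: root_models_def unary_preds_star_ontology)
  consider "\<rho> = Unary 0 0 \<or> (\<exists>S. \<rho> = Binary S 1 0)"
    | "\<rho> = Unary 1 0 \<or> \<rho> = Unary 2 0 \<or> (\<exists>S. \<rho> = Binary S 0 0) \<or> (\<exists>S. \<rho> = Binary S 0 1)"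
    using \<rho> by (auto simp: root_atoms_def unary_preds_star_ontology)
  then show ?thesis
  proof cases
    case 1
    have "case \<alpha> of Unary S x \<Rightarrow> S \<noteq> 1 \<and> (S = 0 \<or> S = P \<longrightarrow> x = Cst a) | Binary S x y \<Rightarrow> y = Cst a"
      if "\<alpha> \<in> C" for \<alpha>
      using that unfolding C
    proof (induction rule: chase.induct)
      case (data \<alpha>)
      then show ?case using P by simp
    next
      case (step \<sigma> v \<psi>)
      then show ?case
        using P 1 by (auto simp: star_ontology_def tgd_in_def tgd_out_def fire_def)
    qed
    then have "\<forall>R x y. Binary R x y \<in> C \<longrightarrow> y = Cst a" by fastforce
    then show ?thesis by blast
  next
    case 2
    have "case \<alpha> of Unary S x \<Rightarrow> S \<noteq> 0 \<and> (S = 1 \<or> S = P \<longrightarrow> x = Cst a) | Binary S x y \<Rightarrow> x = Cst a"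
      if "\<alpha> \<in> C" for \<alpha>
      using that unfolding C
    proof (induction rule: chase.induct)
      case (data \<alpha>)
      then show ?case using P by simp
    next
      case (step \<sigma> v \<psi>)
      then show ?case
        using P 2 by (auto simp: star_ontology_def tgd_in_def tgd_out_def fire_def)
    qed
    then have "\<forall>R x y. Binary R x y \<in> C \<longrightarrow> x = Cst a" by fastforce
    then show ?thesis by blast
  qed
qed

lemma of_depth_star_ontology: "of_depth (star_ontology E) 1"
  unfolding of_depth_def
proof (intro conjI ballI allI impI notI)
  let ?\<sigma> = "Tgd (Unary 3 0) [Binary 0 0 1]"
  let ?C = "chase (insert ?\<sigma> (star_ontology E)) {Unary 3 0}"
  have "map_atom Cst (Unary 3 0) \<in> ?C" by (rule chase.data) simp
  then have "map_atom (fire ?\<sigma> (\<lambda>_. Cst 0)) (Binary 0 0 1) \<in> ?C"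
    by (intro chase.step) auto
  then have "Binary 0 (Cst 0) (Null ?\<sigma> 1 (Unary 3 (Cst 0))) \<in> ?C" by (simp add: fire_def)
  then have "has_chain ?C 1"
    unfolding has_chain_def
    by (intro exI[of _ "\<lambda>i. if i = 0 then Cst 0 else Null ?\<sigma> 1 (Unary 3 (Cst 0))"] exI[of _ "\<lambda>_. 0"]) simp
  moreover have "?C \<in> root_models (star_ontology E)"
    using zero_in_binary_preds[of E] by (fastforce simp: root_models_def unary_preds_star_ontology root_atoms_def)
  ultimately show "\<exists>C\<in>root_models (star_ontology E). has_chain C 1" by blast
next
  fix C m assume C: "C \<in> root_models (star_ontology E)" and m: "1 < m" and "has_chain C m"
  then obtain w R where w: "\<And>i. i < m \<Longrightarrow> w i \<noteq> w (Suc i) \<and> Binary (R i) (w i) (w (Suc i)) \<in> C"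
    unfolding has_chain_def by blast
  obtain c where "(\<forall>R x y. Binary R x y \<in> C \<longrightarrow> y = c) \<or> (\<forall>R x y. Binary R x y \<in> C \<longrightarrow> x = c)"
    using root_model_edges[OF C] by blast
  \<comment> \<open>Two successive edges with a common target or a common source force a loop, which
    chains exclude.\<close>
  moreover have "w 0 \<noteq> w 1" "w 1 \<noteq> w 2" "Binary (R 0) (w 0) (w 1) \<in> C" "Binary (R 1) (w 1) (w 2) \<in> C"
    using w[of 0] w[of 1] m by (simp_all add: numeral_2_eq_2)
  ultimately show False by blast
qed

section \<open>Entailment over a single constant\<close>

lemma ind_point_instance: "ind (point_instance E p) = {0}"
  by (auto simp: ind_def point_instance_def)

lemma star_model_is_model:
  "is_model (star_ontology E) (point_instance E p) {0, 1, 2} (\<lambda>_. 0) (star_model E p)"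
proof -
  have "sat_tgd {0, 1, 2} (star_model E p) (tgd_in E)"
    unfolding sat_tgd_def
  proof (intro allI impI, elim conjE)
    fix v :: "var \<Rightarrow> nat"
    assume v: "range v \<subseteq> {0, 1, 2}" "map_atom v (body (tgd_in E)) \<in> star_model E p"
    then have "v 0 = 0" by (auto simp: tgd_in_def star_model_def point_instance_def)
    then show "\<exists>v'. range v' \<subseteq> {0, 1, 2} \<and> (\<forall>x\<in>set_atom (body (tgd_in E)). v' x = v x) \<and>
        (\<forall>\<psi>\<in>set (head (tgd_in E)). map_atom v' \<psi> \<in> star_model E p)"
      by (intro exI[of _ "\<lambda>x. if x = 0 then 0 else 1"]) (auto simp: tgd_in_def star_model_def)
  qed
  moreover have "sat_tgd {0, 1, 2} (star_model E p) (tgd_out E)"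
    unfolding sat_tgd_def
  proof (intro allI impI, elim conjE)
    fix v :: "var \<Rightarrow> nat"
    assume v: "range v \<subseteq> {0, 1, 2}" "map_atom v (body (tgd_out E)) \<in> star_model E p"
    then have "v 0 = 0" by (auto simp: tgd_out_def star_model_def point_instance_def)
    then show "\<exists>v'. range v' \<subseteq> {0, 1, 2} \<and> (\<forall>x\<in>set_atom (body (tgd_out E)). v' x = v x) \<and>
        (\<forall>\<psi>\<in>set (head (tgd_out E)). map_atom v' \<psi> \<in> star_model E p)"
      by (intro exI[of _ "\<lambda>x. if x = 0 then 0 else 2"]) (auto simp: tgd_out_def star_model_def)
  qed
  moreover have "map_atom (\<lambda>_. 0) \<alpha> \<in> star_model E p" if "\<alpha> \<in> point_instance E p" for \<alpha>
    using that by (auto simp: point_instance_def star_model_def)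
  moreover have "set_atom \<alpha> \<subseteq> {0, 1, 2}" if "\<alpha> \<in> star_model E p" for \<alpha>
    using that by (auto simp: point_instance_def star_model_def)
  ultimately show ?thesis by (auto simp: is_model_def star_ontology_def)
qed

text \<open>An entailed atom holds in \<open>star_model\<close>, where every added fact involves a
  null.\<close>

lemma complete_point_instance: "complete_instance (star_ontology E) (point_instance E p)"
  unfolding complete_instance_def
proof (intro allI impI, elim conjE)
  fix \<alpha> assume "set_atom \<alpha> \<subseteq> ind (point_instance E p)"
    and "entails_atom (star_ontology E) (point_instance E p) \<alpha>"
  then have "set_atom \<alpha> \<subseteq> {0}" "map_atom (\<lambda>_. 0) \<alpha> \<in> star_model E p"
    using star_model_is_model[of E p] unfolding entails_atom_def ind_point_instance by simp_all
  then show "\<alpha> \<in> point_instance E p" by (cases \<alpha>) (auto simp: star_model_def)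
qed

lemma entails_cut_query:
  "entails_cq (star_ontology E) (point_instance E p) (cut_query s t E) a \<longleftrightarrow>
    (\<exists>X. s \<in> X \<and> t \<notin> X \<and> (\<forall>(u, v)\<in>set E - p. u \<in> X \<longrightarrow> v \<in> X))"
proof
  assume entails: "entails_cq (star_ontology E) (point_instance E p) (cut_query s t E) a"
  have "sat_cq {0, 1, 2} (star_model E p) ((\<lambda>_. 0) \<circ> a) (cut_query s t E)"
    by (rule entails[unfolded entails_cq_def, rule_format, OF star_model_is_model])
  then obtain h where "\<forall>\<alpha>\<in>set (cq_atoms (cut_query s t E)). map_atom h \<alpha> \<in> star_model E p"
    unfolding sat_cq_def by (elim exE conjE)
  note h = bspec[OF this]
  let ?X = "{u. h (node_var u) = 1}"
  have "map_atom h (Unary 2 (node_var s)) \<in> star_model E p" "map_atom h (Unary 0 (node_var t)) \<in> star_model E p"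
    by (rule h, simp add: cut_query_def)+
  then have "s \<in> ?X" "t \<notin> ?X" by (auto simp: star_model_def point_instance_def)
  moreover have "v \<in> ?X" if e: "(u, v) \<in> set E - p" and u: "u \<in> ?X" for u v
  proof -
    have "map_atom h (Binary 0 (node_var u) (edge_var (u, v))) \<in> star_model E p"
      "map_atom h (Binary (req (u, v)) (node_var v) (edge_var (u, v))) \<in> star_model E p"
      using e by (intro h; force simp: cut_query_def)+
    then show ?thesis using e u by (auto simp: star_model_def point_instance_def)
  qed
  ultimately show "\<exists>X. s \<in> X \<and> t \<notin> X \<and> (\<forall>(u, v)\<in>set E - p. u \<in> X \<longrightarrow> v \<in> X)"
    by (intro exI[of _ ?X]) blast
next
  assume "\<exists>X. s \<in> X \<and> t \<notin> X \<and> (\<forall>(u, v)\<in>set E - p. u \<in> X \<longrightarrow> v \<in> X)"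
  then obtain X where X: "s \<in> X" "t \<notin> X" "\<And>u v. (u, v) \<in> set E - p \<Longrightarrow> u \<in> X \<Longrightarrow> v \<in> X"
    by blast
  show "entails_cq (star_ontology E) (point_instance E p) (cut_query s t E) a"
    unfolding entails_cq_def
  proof (intro allI impI)
    fix D c F assume M: "is_model (star_ontology E) (point_instance E p) D c F"
    have c: "c i \<in> D" for i using M by (auto simp: is_model_def)
    have cF: "map_atom c \<alpha> \<in> F" if "\<alpha> \<in> point_instance E p" for \<alpha>
      using M that by (auto simp: is_model_def)
    have "sat_tgd D F (tgd_in E)" "sat_tgd D F (tgd_out E)"
      using M by (auto simp: is_model_def star_ontology_def)
    note sat = this[unfolded sat_tgd_def, rule_format, of "\<lambda>_. c 0"]
    obtain v1 where v1: "range v1 \<subseteq> D" "v1 0 = c 0" "\<forall>\<psi>\<in>set (head (tgd_in E)). map_atom v1 \<psi> \<in> F"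
      using sat(1) c cF[of "Unary 0 0"] by (auto simp: tgd_in_def point_instance_def)
    obtain v2 where v2: "range v2 \<subseteq> D" "v2 0 = c 0" "\<forall>\<psi>\<in>set (head (tgd_out E)). map_atom v2 \<psi> \<in> F"
      using sat(2) c cF[of "Unary 1 0"] by (auto simp: tgd_out_def point_instance_def)
    have in_F: "Unary 2 (v1 1) \<in> F" "Binary P (v1 1) (c 0) \<in> F" "Binary P (c 0) (v2 1) \<in> F"
      if "P \<in> set (role_preds E)" for P
      using v1 v2 that by (auto simp: tgd_in_def tgd_out_def)
    have role: "0 \<in> set (role_preds E)" "\<And>e. e \<in> set E \<Longrightarrow> req e \<in> set (role_preds E)"
      by (auto simp: role_preds_def)
    define h where "h x = (if x \<in> node_var ` X then v1 1
      else if x \<in> edge_var ` {e \<in> set E - p. snd e \<notin> X} then v2 1 else c 0)" for x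
    have h_node: "h (node_var u) = (if u \<in> X then v1 1 else c 0)" for u
      by (auto simp: h_def)
    have h_edge: "h (edge_var e) = (if e \<in> set E - p \<and> snd e \<notin> X then v2 1 else c 0)" for e
      by (auto simp: h_def)
    have "map_atom h \<alpha> \<in> F" if "\<alpha> \<in> set (cq_atoms (cut_query s t E))" for \<alpha>
    proof -
      consider "\<alpha> = Unary 2 (node_var s)" | "\<alpha> = Unary 0 (node_var t)"
        | e where "e \<in> set E" "\<alpha> = Binary 0 (node_var (fst e)) (edge_var e)"
        | e where "e \<in> set E" "\<alpha> = Binary (req e) (node_var (snd e)) (edge_var e)"
        using \<open>\<alpha> \<in> _\<close> by (auto simp: cut_query_def)
      then show ?thesis
      proof cases
        case 1
        then show ?thesis using X in_F(1)[OF role(1)] by (simp add: h_node)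
      next
        case 2
        then show ?thesis using X cF[of "Unary 0 0"] by (simp add: h_node point_instance_def)
      next
        case 3
        then show ?thesis
          using X(3)[of "fst e" "snd e"] in_F(2,3)[OF role(1)] cF[of "Binary 0 0 0"]
          by (auto simp: h_node h_edge point_instance_def)
      next
        case 4
        then show ?thesis
          using in_F(2,3)[OF role(2)[OF 4(1)]] cF[of "Binary (req e) 0 0"]
          by (auto simp: h_node h_edge point_instance_def)
      qed
    qed
    moreover have "range h \<subseteq> D" using v1(1) v2(1) c by (auto simp: h_def)
    ultimately show "sat_cq D F (c \<circ> a) (cut_query s t E)"
      unfolding sat_cq_def by (intro exI[of _ h]) (auto simp: cut_query_def)
  qed
qed

section \<open>Rewritings over a single constant are monotone formulas\<close>

primrec ground :: "pe \<Rightarrow> nat atom mform" where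
  "ground (Atom \<alpha>) = MVar (map_atom (\<lambda>_. 0) \<alpha>)"
| "ground (Eq x y) = MConst True"
| "ground (And f g) = MAnd (ground f) (ground g)"
| "ground (Or f g) = MOr (ground f) (ground g)"
| "ground (Ex x f) = ground f"

lemma meval_ground: "meval F (ground f) \<longleftrightarrow> sat_pe {0} F (\<lambda>_. 0) f"
  by (induction f) (auto simp: fun_upd_idem)

lemma mleaves_ground: "mleaves (ground f) \<le> pe_size f"
proof (induction f)
  case (Atom \<alpha>)
  then show ?case by (cases \<alpha>) auto
qed auto

lemma rewriting_ground:
  assumes "pe_rewriting (cut_query s t E) (star_ontology E) f"
  shows "meval (point_instance E p) (ground f) \<longleftrightarrow>
    (\<exists>X. s \<in> X \<and> t \<notin> X \<and> (\<forall>(u, v)\<in>set E - p. u \<in> X \<longrightarrow> v \<in> X))"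
proof -
  have "data_instance (point_instance E p)" by (simp add: data_instance_def point_instance_def)
  then have "entails_cq (star_ontology E) (point_instance E p) (cut_query s t E) (\<lambda>_. 0) \<longleftrightarrow>
      sat_pe {0} (point_instance E p) (\<lambda>_. 0) f"
    using assms complete_point_instance[of E p] unfolding pe_rewriting_def ind_point_instance[of E p, symmetric]
    by (auto simp: cut_query_def)
  then show ?thesis unfolding meval_ground entails_cut_query by blast
qed

section \<open>Paths and cuts in layered graphs\<close>

definition grid :: "nat \<Rightarrow> nat \<Rightarrow> (nat \<times> nat) list" where
  "grid l w = map (\<lambda>(j, a, b). (prod_encode (j, a), prod_encode (Suc j, b)))
    (List.product [0..<Suc l] (List.product [0..<w] [0..<w]))"

definition path_edges :: "nat list \<Rightarrow> (nat \<times> nat) set" where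
  "path_edges x = {(prod_encode (j, (0 # x) ! j), prod_encode (Suc j, (x @ [0]) ! j)) |j. j \<le> length x}"

text \<open>The edges leaving the set of nodes \<open>(j, (0 # y) ! j)\<close>. This set ends at
  layer \<open>length y\<close>, so from there every edge leaves it and \<open>b\<close> is
  arbitrary.\<close>

definition cut_edges :: "nat list \<Rightarrow> (nat \<times> nat) set" where
  "cut_edges y = {(prod_encode (j, (0 # y) ! j), prod_encode (Suc j, b)) |j b.
    j \<le> length y \<and> (j < length y \<longrightarrow> b \<noteq> y ! j)}"

lemma mem_grid:
  "(u, v) \<in> set (grid l w) \<longleftrightarrow>
    (\<exists>j a b. j \<le> l \<and> a < w \<and> b < w \<and> u = prod_encode (j, a) \<and> v = prod_encode (Suc j, b))"
  by (auto simp: grid_def image_iff less_Suc_eq_le Bex_def simp del: upt_Suc)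

lemma length_grid: "length (grid l w) = Suc l * (w * w)"
  by (simp add: grid_def)

lemma nth_word_less: "x \<in> words w l \<Longrightarrow> i < l \<Longrightarrow> x ! i < w"
  unfolding words_def using nth_mem by blast

lemma path_edges_subset_grid:
  assumes "x \<in> words w l" "0 < w"
  shows "path_edges x \<subseteq> set (grid l w)"
proof -
  have [simp]: "length x = l" using assms by (simp add: words_def)
  have "(0 # x) ! j < w" "(x @ [0]) ! j < w" if "j \<le> l" for j
    using that assms nth_word_less[OF assms(1)] by (auto simp: nth_Cons' nth_append)
  then show ?thesis by (auto simp: path_edges_def mem_grid)
qed

lemma path_not_separated:
  assumes "x \<in> words w l" "0 < w" "prod_encode (0, 0) \<in> X"
    and closed: "\<And>u v. (u, v) \<in> set (grid l w) - - path_edges x \<Longrightarrow> u \<in> X \<Longrightarrow> v \<in> X"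
  shows "prod_encode (Suc l, 0) \<in> X"
proof -
  have [simp]: "length x = l" using assms by (simp add: words_def)
  have edge: "prod_encode (Suc j, (x @ [0]) ! j) \<in> X" if "j \<le> l" "prod_encode (j, (0 # x) ! j) \<in> X" for j
  proof (rule closed[OF _ that(2)])
    have "(prod_encode (j, (0 # x) ! j), prod_encode (Suc j, (x @ [0]) ! j)) \<in> path_edges x"
      using that(1) by (auto simp: path_edges_def)
    then show "(prod_encode (j, (0 # x) ! j), prod_encode (Suc j, (x @ [0]) ! j)) \<in> set (grid l w) - - path_edges x"
      using path_edges_subset_grid[OF assms(1,2)] by blast
  qed
  have "prod_encode (j, (0 # x) ! j) \<in> X" if "j \<le> l" for j
    using that
  proof (induction j)
    case 0
    then show ?case using assms by simp
  next
    case (Suc j)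
    then show ?case using edge[of j] by (simp add: nth_append)
  qed
  from edge[OF order_refl this[OF order_refl]] show ?thesis by (simp add: nth_append)
qed

lemma cut_separated:
  assumes "y \<in> words w l"
  shows "\<exists>X. prod_encode (0, 0) \<in> X \<and> prod_encode (Suc l, 0) \<notin> X \<and>
    (\<forall>(u, v)\<in>set (grid l w) - cut_edges y. u \<in> X \<longrightarrow> v \<in> X)"
proof -
  have [simp]: "length y = l" using assms by (simp add: words_def)
  let ?X = "{prod_encode (j, (0 # y) ! j) |j. j \<le> l}"
  have "v \<in> ?X" if "(u, v) \<in> set (grid l w)" "(u, v) \<notin> cut_edges y" "u \<in> ?X" for u v
  proof -
    obtain j a b where *: "j \<le> l" "u = prod_encode (j, a)" "v = prod_encode (Suc j, b)"
      using \<open>(u, v) \<in> set (grid l w)\<close> by (auto simp: mem_grid)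
    then have "a = (0 # y) ! j" using \<open>u \<in> ?X\<close> by auto
    then have "j < l" "b = y ! j" using * \<open>(u, v) \<notin> cut_edges y\<close> by (auto simp: cut_edges_def)
    then show ?thesis using * by (auto intro!: exI[of _ "Suc j"])
  qed
  moreover have "prod_encode (0, 0) \<in> ?X" by force
  moreover have "prod_encode (Suc l, 0) \<notin> ?X" by auto
  ultimately show ?thesis by (intro exI[of _ ?X]) blast
qed

lemma fork_of_path_cut:
  assumes "(u, v) \<in> cut_edges y" "(u, v) \<in> path_edges x" "length y = length x"
  shows "fork y x (fst (prod_decode u))"
  using assms by (auto simp: cut_edges_def path_edges_def fork_def nth_append split: if_splits)

section \<open>From rewritings to the fork game\<close>

lemma req_mem_point_instance: "Binary (req e) 0 0 \<in> point_instance E p \<longleftrightarrow> e \<in> set E \<and> e \<in> p"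
  by (auto simp: point_instance_def)

text \<open>Only the \<open>req\<close> facts depend on the switched-off edges, so a separating fact
  names a path edge that leaves the cut. Its layer is a fork and depends on the fact alone, as a
  leaf of a protocol requires.\<close>

lemma separating_atom_fork:
  fixes \<alpha> :: "nat atom"
  shows "\<exists>i. \<forall>y x. \<alpha> \<in> point_instance E (cut_edges y) \<and> \<alpha> \<notin> point_instance E (- path_edges x) \<longrightarrow>
    length y = length x \<longrightarrow> fork y x i"
proof (cases "\<exists>u v. \<alpha> = Binary (req (u, v)) 0 0")
  case True
  then obtain u v where "\<alpha> = Binary (req (u, v)) 0 0" by blast
  then show ?thesis
    by (intro exI[of _ "fst (prod_decode u)"]) (auto simp: req_mem_point_instance intro: fork_of_path_cut)
next
  case False
  then show ?thesis by (auto simp: point_instance_def)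
qed

abbreviation grid_query :: "nat \<Rightarrow> nat \<Rightarrow> cq" where
  "grid_query l w \<equiv> cut_query (prod_encode (0, 0)) (prod_encode (Suc l, 0)) (grid l w)"

lemma comm_of_rewriting:
  assumes "pe_rewriting (grid_query l w) (star_ontology (grid l w)) f" "0 < w"
    and "2 ^ d * pe_size f \<le> 3 ^ d"
  shows "comm fork (2 * d) (words w l) (words w l)"
proof -
  let ?E = "grid l w"
  \<comment> \<open>\<open>comm_of_mform\<close> asks for an answer valid for all lists, not just
    words; the length guard provides this and is void on words of equal length.\<close>
  let ?R = "\<lambda>y x i. length y = length x \<longrightarrow> fork y x i"
  have "comm ?R (2 * d) (words w l) (words w l)"
  proof (rule comm_of_mform[where a = "\<lambda>y. point_instance ?E (cut_edges y)"
        and b = "\<lambda>x. point_instance ?E (- path_edges x)" and f = "ground f"])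
    show "\<exists>i. \<forall>y x. \<alpha> \<in> point_instance ?E (cut_edges y) \<and> \<alpha> \<notin> point_instance ?E (- path_edges x) \<longrightarrow> ?R y x i" for \<alpha>
      by (rule separating_atom_fork)
    have "2 ^ d * mleaves (ground f) \<le> 2 ^ d * pe_size f" by (simp add: mleaves_ground)
    then show "2 ^ d * mleaves (ground f) \<le> 3 ^ d" using assms(3) by (rule order_trans)
    show "meval (point_instance ?E (cut_edges y)) (ground f)" if "y \<in> words w l" for y
      using cut_separated[OF that] unfolding rewriting_ground[OF assms(1)] .
    show "\<not> meval (point_instance ?E (- path_edges x)) (ground f)" if "x \<in> words w l" for x
      using path_not_separated[OF that assms(2)] unfolding rewriting_ground[OF assms(1)] by blast
  qed
  then show ?thesis
    by (rule comm_simulate[where f = id and g = id and h = id]) (auto simp: words_def)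
qed

lemma rewriting_size_lower_bound:
  assumes "2 \<le> r" "l = 2 ^ r" "w = 2 ^ (8 * r)"
    and "pe_rewriting (grid_query l w) (star_ontology (grid l w)) f"
  shows "(3 / 2) ^ (r * r div 2) \<le> real (pe_size f)"
proof (rule ccontr)
  \<comment> \<open>Balancing spends two bits per factor \<open>3 / 2\<close>, so
    \<open>r * r\<close> bits pay for \<open>r * r div 2\<close> factors.\<close>
  let ?d = "r * r div 2"
  assume "\<not> ?thesis"
  then have "real (pe_size f) * 2 ^ ?d \<le> 3 ^ ?d" by (simp add: power_divide field_simps)
  then have "real (2 ^ ?d * pe_size f) \<le> real (3 ^ ?d)" by (simp add: mult.commute)
  then have "2 ^ ?d * pe_size f \<le> 3 ^ ?d" by (simp only: of_nat_le_iff)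
  then have "comm fork (2 * ?d) (words w l) (words w l)"
    using assms(3) by (intro comm_of_rewriting[OF assms(4)]) auto
  then have "comm fork (r * r) (words w l) (words w l)" by (rule comm_mono) simp
  then show False using fork_lower_bound[OF assms(1)] assms(2,3) by simp
qed

section \<open>Sizes\<close>

lemma cut_query_size: "cq_size (cut_query s t E) \<le> 16 * (length E + 1)"
proof -
  let ?as = "cq_atoms (cut_query s t E)"
  have len: "length ?as = 2 * length E + 2" by (simp add: cut_query_def)
  have atoms: "card (set_atom \<alpha>) \<le> 2" "atom_size \<alpha> \<le> 3" "finite (set_atom \<alpha>)" for \<alpha> :: "nat atom"
    by (cases \<alpha>; simp add: card_insert_if)+
  have "card (ex_vars (cut_query s t E)) \<le> card (\<Union>\<alpha>\<in>set ?as. set_atom \<alpha>)"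
    unfolding ex_vars_def by (rule card_mono) (auto intro: atoms)
  also have "\<dots> \<le> (\<Sum>\<alpha>\<in>set ?as. card (set_atom \<alpha>))" by (rule card_UN_le) simp
  also have "\<dots> \<le> card (set ?as) * 2" using atoms by (intro sum_bounded_above[of _ _ "2::nat", simplified]) 
  also have "\<dots> \<le> length ?as * 2" using card_length[of ?as] by simp
  finally have "card (ex_vars (cut_query s t E)) \<le> 2 * length ?as" by simp
  moreover have "(\<Sum>\<alpha>\<leftarrow>?as. atom_size \<alpha>) \<le> length ?as * 3"
    using sum_list_mono[of ?as atom_size "\<lambda>_. 3"] atoms(2) by (simp add: sum_list_triv)
  moreover have "ans_vars (cut_query s t E) = []" by (simp add: cut_query_def)
  ultimately show ?thesis unfolding cq_size_def len by simp
qed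

lemma star_ontology_size: "ontology_size (star_ontology E) \<le> 5 * (length E + 1)"
proof -
  have "tgd_in E \<noteq> tgd_out E" by (simp add: tgd_in_def tgd_out_def)
  then show ?thesis
    by (simp add: ontology_size_def star_ontology_def tgd_in_def tgd_out_def role_preds_def)
qed

lemma length_grid_floor_log:
  assumes "1 \<le> n"
  shows "length (grid (2 ^ floor_log n) (2 ^ (8 * floor_log n))) + 1 \<le> 3 * n ^ 17"
proof -
  define N :: nat where "N = 2 ^ floor_log n"
  have N: "1 \<le> N" "N \<le> n" using floor_log_exp2_le[of n] assms by (auto simp: N_def)
  have w: "(2::nat) ^ (8 * floor_log n) = N ^ 8"
    by (simp add: N_def power_mult[symmetric] mult.commute)
  have "length (grid (2 ^ floor_log n) (2 ^ (8 * floor_log n))) + 1 = Suc N * N ^ 16 + 1"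
    unfolding length_grid w by (simp add: N_def flip: power_add)
  also have "\<dots> \<le> (N + N) * N ^ 16 + N ^ 17" using N by (intro add_mono mult_le_mono1) auto
  also have "\<dots> = 3 * N ^ 17" by (simp add: power_numeral_reduce)
  also have "\<dots> \<le> 3 * n ^ 17" using N by (intro mult_le_mono2 power_mono) auto
  finally show ?thesis .
qed

lemma powr_ln_le_power_floor_log:
  assumes n: "4 \<le> n"
  shows "real n powr (ln (3 / 2) / 16 * ln (real n)) \<le> (3 / 2) ^ (floor_log n * floor_log n div 2)"
proof -
  define r where "r = floor_log n"
  have r: "2 \<le> r" using n floor_log_le_iff[of 4 n] floor_log_power[of 2] by (simp add: r_def)
  have "n \<le> 2 ^ Suc r" using floor_log_exp2_ge[of n] by (simp add: r_def)
  then have "real n \<le> real (2 ^ Suc r)" by (simp only: of_nat_le_iff)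
  then have "real n \<le> 2 ^ Suc r" by simp
  then have "ln (real n) \<le> ln (2 ^ Suc r)" using n by (subst ln_le_cancel_iff) auto
  also have "\<dots> = real (Suc r) * ln 2" by (simp only: ln_realpow)
  also have "\<dots> \<le> real (Suc r) * 1" using ln_2_less_1 by (intro mult_left_mono) auto
  finally have "ln (real n) \<le> real r + 1" by simp
  then have ln_n: "ln (real n) * ln (real n) \<le> (real r + 1) * (real r + 1)"
    using n by (intro mult_mono) auto
  have "real (r * r) \<le> 2 * real (r * r div 2) + 1" by linarith
  \<comment> \<open>With the rounding in \<open>r * r div 2\<close>, the factor 8 here accounts for
    the 16 in the exponent. The inequality rests on \<open>r + 1 \<le> 8 * (r - 1)\<close>, which
    needs \<open>2 \<le> r\<close>.\<close>
  moreover have "(real r + 1) * (real r + 1) \<le> 8 * (real r * real r - 1)"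
  proof -
    have "(real r + 1) * (real r + 1) \<le> (real r + 1) * (8 * (real r - 1))"
      using r by (intro mult_left_mono) auto
    then show ?thesis by (simp add: algebra_simps)
  qed
  ultimately have d: "ln (real n) * ln (real n) / 16 \<le> real (r * r div 2)" using ln_n by simp
  have "real n powr (ln (3 / 2) / 16 * ln (real n)) = exp (ln (3 / 2) * (ln (real n) * ln (real n) / 16))"
    using n by (simp add: powr_def)
  also have "\<dots> \<le> exp (ln (3 / 2) * real (r * r div 2))" using d by (simp add: mult_left_mono)
  also have "\<dots> = (3 / 2) ^ (r * r div 2)" by (subst mult.commute, subst exp_of_nat_mult) simp
  finally show ?thesis by (simp add: r_def)
qed

theorem theorem12:
  shows "\<exists>(q :: nat \<Rightarrow> cq) (T :: nat \<Rightarrow> tgd set).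
    (\<forall>n. wf_cq (q n) \<and> ontology (T n) \<and> of_depth (T n) 1) \<and>
    (\<exists>k :: nat. (\<lambda>n. real (cq_size (q n))) \<in> O(\<lambda>n. real n ^ k)) \<and>
    (\<exists>k :: nat. (\<lambda>n. real (ontology_size (T n))) \<in> O(\<lambda>n. real n ^ k)) \<and>
    (\<exists>c :: real. c > 0 \<and> (\<forall>\<^sub>F n in sequentially. \<forall>f. pe_rewriting (q n) (T n) f \<longrightarrow>
      real n powr (c * ln (real n)) \<le> real (pe_size f)))"
proof -
  \<comment> \<open>The fork game is played with \<open>r = floor_log n\<close>: for positive
    \<open>n\<close>, word length is at most \<open>n\<close> and alphabet size at most
    \<open>n ^ 8\<close>.\<close>
  define l w :: "nat \<Rightarrow> nat" where "l n = 2 ^ floor_log n" and "w n = 2 ^ (8 * floor_log n)" for n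
  define q where "q n = grid_query (l n) (w n)" for n
  define T where "T n = star_ontology (grid (l n) (w n))" for n
  have big_O: "(\<lambda>n. real (g n)) \<in> O(\<lambda>n. real n ^ 17)"
    if g: "\<And>n. g n \<le> c * (length (grid (l n) (w n)) + 1)" for g :: "nat \<Rightarrow> nat" and c
  proof (rule bigoI[where c = "real (c * 3)"])
    show "\<forall>\<^sub>F n in sequentially. norm (real (g n)) \<le> real (c * 3) * norm (real n ^ 17)"
      using eventually_ge_at_top[of 1]
    proof eventually_elim
      case (elim n)
      have "g n \<le> c * (3 * n ^ 17)"
        using g[of n] mult_le_mono2[OF length_grid_floor_log[OF elim], of c]
        unfolding l_def w_def by linarith
      then have "real (g n) \<le> real (c * (3 * n ^ 17))" by (simp only: of_nat_le_iff)
      then show ?case by simp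
    qed
  qed
  have "\<forall>\<^sub>F n in sequentially. \<forall>f. pe_rewriting (q n) (T n) f \<longrightarrow>
      real n powr (ln (3 / 2) / 16 * ln (real n)) \<le> real (pe_size f)"
    using eventually_ge_at_top[of 4]
  proof eventually_elim
    case (elim n)
    have r: "2 \<le> floor_log n" using elim floor_log_le_iff[of 4 n] floor_log_power[of 2] by simp
    show ?case
    proof (intro allI impI)
      fix f assume "pe_rewriting (q n) (T n) f"
      then have "(3 / 2) ^ (floor_log n * floor_log n div 2) \<le> real (pe_size f)"
        by (intro rewriting_size_lower_bound[OF r l_def w_def]) (simp add: q_def T_def)
      with powr_ln_le_power_floor_log[OF elim]
      show "real n powr (ln (3 / 2) / 16 * ln (real n)) \<le> real (pe_size f)" by linarith
    qed
  qed
  moreover have "(0::real) < ln (3 / 2) / 16" by simp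
  moreover have "(\<lambda>n. real (cq_size (q n))) \<in> O(\<lambda>n. real n ^ 17)"
    unfolding q_def by (rule big_O, rule cut_query_size)
  moreover have "(\<lambda>n. real (ontology_size (T n))) \<in> O(\<lambda>n. real n ^ 17)"
    unfolding T_def by (rule big_O, rule star_ontology_size)
  moreover have "\<forall>n. wf_cq (q n) \<and> ontology (T n) \<and> of_depth (T n) 1"
    unfolding q_def T_def
    by (intro allI conjI wf_cut_query ontology_star_ontology of_depth_star_ontology)
  ultimately show ?thesis
    by (intro exI[of _ q] exI[of _ T]) blast
qed

end
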